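(* Let $\mathbf{G}\subset\mathbb{R}^n$ be a bounded open set with real algebraic boundary $\partial\mathbf{G}$, such that $\mathbf{G}=\mathrm{int}\,\overline{\mathbf{G}}$, the boundary $\partial\mathbf{G}$ has degree $d$, and the point $0$ does not belong to the real zero set of the ideal $I(\partial\mathbf{G})$. Let $y_\alpha=\int_{\mathbf{G}}\mathbf{x}^\alpha d\mathbf{x}$. Then the linear system in the unknowns $\mathbf{g}=(g_\beta)_{\beta\in\mathbb{N}^n_d\setminus\{0\}}\in\mathbb{R}^{s(d)-1}$, $$\mathbf{M}^d_{2d}(\mathbf{y})\begin{bmatrix}-1\\ \mathbf{g}\end{bmatrix}=0,\quad\text{i.e.}\quad -y_\alpha+\sum_{0<|\beta|\le d}\frac{n+|\alpha|+|\beta|}{n+|\alpha|}\,y_{\alpha+\beta}\,g_\beta=0\ \ \text{for all }\alpha\in\mathbb{N}^n_{2d},$$ admits a unique solution, and the polynomial $g(\mathbf{x})=\sum_{0<|\beta|\le d}g_\beta\mathbf{x}^\beta$ (coefficient vector $(0,\mathbf{g})$) satisfies $g(\mathbf{x})=1$ for all $\mathbf{x}\in\partial\mathbf{G}$.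
   Context: $\mathbb{N}^n_k:=\{\alpha\in\mathbb{N}^n:|\alpha|\le k\}$, $s(d)=\binom{n+d}{n}$ is the number of monomials of degree $\le d$. For $k,d\in\mathbb{N}$ the matrix $\mathbf{M}^d_k(\mathbf{y})$ has rows indexed by $\alpha\in\mathbb{N}^n_k$, columns indexed by $\beta\in\mathbb{N}^n_d$ (first column $\beta=0$), and entries $\mathbf{M}^d_k(\mathbf{y})(\alpha,\beta)=\frac{n+|\alpha|+|\beta|}{n+|\alpha|}y_{\alpha+\beta}$. Since $\mathbf{G}=\mathrm{int}\,\overline{\mathbf{G}}$ and $\partial\mathbf{G}$ is real algebraic of dimension $n-1$, its vanishing ideal $I(\partial\mathbf{G})\subset\mathbb{R}[\mathbf{x}]$ is principal, generated by a polynomial $h$; the degree of $\partial\mathbf{G}$ is defined as $\deg h$. *)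

theory Defs
  imports "HOL-Analysis.Analysis"
begin

text \<open>Multi-indices on the coordinate type 'n (so points live in real^'n, n = CARD('n)).
  Real polynomials in n variables are represented by finitely supported coefficient
  functions c :: ('n \<Rightarrow> nat) \<Rightarrow> real.\<close>

definition mdeg :: "('n::finite \<Rightarrow> nat) \<Rightarrow> nat" where
  "mdeg \<alpha> = (\<Sum>i\<in>UNIV. \<alpha> i)"

definition mmonom :: "('n::finite \<Rightarrow> nat) \<Rightarrow> real^'n \<Rightarrow> real" where
  "mmonom \<alpha> x = (\<Prod>i\<in>UNIV. (x $ i) ^ (\<alpha> i))"

definition is_mpoly :: "(('n::finite \<Rightarrow> nat) \<Rightarrow> real) \<Rightarrow> bool" where
  "is_mpoly c \<longleftrightarrow> finite {\<alpha>. c \<alpha> \<noteq> 0}"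

definition mpoly_eval :: "(('n::finite \<Rightarrow> nat) \<Rightarrow> real) \<Rightarrow> real^'n \<Rightarrow> real" where
  "mpoly_eval c x = (\<Sum>\<alpha>\<in>{\<alpha>. c \<alpha> \<noteq> 0}. c \<alpha> * mmonom \<alpha> x)"

definition mpoly_degree :: "(('n::finite \<Rightarrow> nat) \<Rightarrow> real) \<Rightarrow> nat" where
  "mpoly_degree c = Max (insert 0 (mdeg ` {\<alpha>. c \<alpha> \<noteq> 0}))"

definition vanishing_ideal :: "(real^'n::finite) set \<Rightarrow> (('n \<Rightarrow> nat) \<Rightarrow> real) set" where
  "vanishing_ideal S = {p. is_mpoly p \<and> (\<forall>x\<in>S. mpoly_eval p x = 0)}"

text \<open>h generates the ideal I (as principal ideal of the polynomial ring).
  Polynomial identities are checked via evaluation (equivalent over an infinite field).\<close>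
definition generates_ideal :: "(('n::finite \<Rightarrow> nat) \<Rightarrow> real) \<Rightarrow> (('n \<Rightarrow> nat) \<Rightarrow> real) set \<Rightarrow> bool" where
  "generates_ideal h I \<longleftrightarrow> h \<in> I \<and>
     (\<forall>p\<in>I. \<exists>q. is_mpoly q \<and> (\<forall>x. mpoly_eval p x = mpoly_eval h x * mpoly_eval q x))"

definition real_zero_set :: "(('n::finite \<Rightarrow> nat) \<Rightarrow> real) set \<Rightarrow> (real^'n) set" where
  "real_zero_set I = {x. \<forall>p\<in>I. mpoly_eval p x = 0}"

definition moment :: "(real^'n::finite) set \<Rightarrow> ('n \<Rightarrow> nat) \<Rightarrow> real" where
  "moment G \<alpha> = integral G (mmonom \<alpha>)"

end

theory Submission
  imports Defs "HOL-Computational_Algebra.Polynomial"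
begin

text \<open>
  Write \<open>n\<close> for the dimension. By the divergence theorem, the rows of the system say that the field
  \<open>x \<mapsto> x\<^sup>\<alpha> (g x - 1) x\<close> has zero flux through the frontier of \<open>G\<close>. This holds for
  \<open>g = 1 - h / h 0\<close>, which gives existence.

  For uniqueness let \<open>q\<close> be the difference of two solutions, and let \<open>E\<close> be the radial derivative of
  \<open>h\<close>. Combining the rows with the coefficients of \<open>q E\<close>, which has degree at most \<open>2 d\<close>, the field
  \<open>q\<^sup>2 E x\<close> has zero flux. The generator \<open>h\<close> has constant sign on \<open>G\<close>, so the outer normal is a
  multiple of the gradient of \<open>h\<close> of constant sign, and the flux density is \<open>q\<^sup>2 E\<^sup>2\<close> up to a positive
  factor and a fixed sign. Hence \<open>q E\<close> vanishes on the frontier and \<open>h\<close> divides \<open>q E\<close>. Comparing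
  orders of vanishing along a ray through a frontier point, \<open>q\<close> vanishes there. Hence \<open>h\<close> divides
  \<open>q\<close>, and \<open>q = 0\<close> by comparing degrees and values at \<open>0\<close>.

  Surface integrals are avoided by multiplying with the cutoff \<open>h\<^sup>2 / (h\<^sup>2 + \<epsilon>\<^sup>2)\<close>, which vanishes to
  second order on the frontier, and letting \<open>\<epsilon>\<close> tend to zero.
\<close>

section \<open>Polynomial functions\<close>

text \<open>The frontier may be singular, so neither a surface measure nor a normal field is at
  hand. In the flux argument only points with \<open>q E\<close> nonzero matter: there
  \<open>E\<close> is nonzero, so one of \<open>x\<close> and \<open>-x\<close> is a direction in
  which \<open>h\<close> increases, and nearby lines in that direction cross the frontier once,
  locally. The weight \<open>q E\<close> in the test field turns the flux density into a square, and
  its degree, at most d + d, is where the bound \<open>2 * d\<close> on the rows comes from.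

  A constant sign of \<open>h\<close> on \<open>G\<close> keeps different pieces of the frontier
  from cancelling. It rests on two facts: \<open>G = interior (closure G)\<close> forbids
  \<open>G\<close> on both sides of a regular piece, and the generator of a vanishing ideal is
  square-free enough that the points where \<open>h\<close> fails to be transversal are too few to
  separate space.

  Multivariate divisibility is brought down to one variable. Restriction to a line gives a
  \<open>poly\<close>, and roots, degrees and orders of vanishing of such restrictions carry the
  algebra; the ideal enters only as the rule that a polynomial function vanishing wherever
  \<open>h\<close> does is a multiple of \<open>h\<close>.\<close>

lemma real_polynomial_function_continuous_on:
  "real_polynomial_function p \<Longrightarrow> continuous_on S p"
  by (simp add: continuous_at_imp_continuous_on continuous_real_polymonial_function)

lemma real_polynomial_function_on_line:
  assumes "real_polynomial_function p"
  shows "\<exists>P. \<forall>t. poly P t = p (a + t *\<^sub>R v)"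
  using assms
proof (induction p rule: real_polynomial_function.induct)
  case (linear f)
  then interpret bounded_linear f .
  show ?case
    by (intro exI[of _ "[:f a, f v:]"]) (simp add: add scaleR)
next
  case (const c)
  show ?case by (intro exI[of _ "[:c:]"]) simp
next
  case (add f g)
  then obtain P Q where "\<forall>t. poly P t = f (a + t *\<^sub>R v)" "\<forall>t. poly Q t = g (a + t *\<^sub>R v)"
    by blast
  then show ?case by (intro exI[of _ "P + Q"]) simp
next
  case (mult f g)
  then obtain P Q where "\<forall>t. poly P t = f (a + t *\<^sub>R v)" "\<forall>t. poly Q t = g (a + t *\<^sub>R v)"
    by blast
  then show ?case by (intro exI[of _ "P * Q"]) simp
qed

text \<open>On the line from a point of \<open>U\<close> to \<open>a\<close> the polynomial is
  nonzero at parameter 1, so it has finitely many roots, whereas infinitely many parameters near 0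
  stay in \<open>U\<close>.\<close>

lemma real_polynomial_function_nonzero_dense:
  fixes p :: "'a::real_normed_vector \<Rightarrow> real"
  assumes p: "real_polynomial_function p" and a: "p a \<noteq> 0" and O: "open U" "U \<noteq> {}"
  shows "\<exists>x\<in>U. p x \<noteq> 0"
proof (rule ccontr)
  assume neg: "\<not> (\<exists>x\<in>U. p x \<noteq> 0)"
  obtain u where u: "u \<in> U" using O by blast
  obtain P where P: "\<And>t. poly P t = p (u + t *\<^sub>R (a - u))"
    using real_polynomial_function_on_line[OF p] by blast
  have "poly P 1 \<noteq> 0" using a P by simp
  then have fin: "finite {t. poly P t = 0}"
    by (intro poly_roots_finite) auto
  have "open ((\<lambda>t::real. u + t *\<^sub>R (a - u)) -` U)"
    by (intro open_vimage O continuous_intros)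
  moreover have "0 \<in> (\<lambda>t::real. u + t *\<^sub>R (a - u)) -` U" using u by simp
  ultimately have "infinite ((\<lambda>t::real. u + t *\<^sub>R (a - u)) -` U)"
    by (intro infinite_openin[of UNIV _ 0]) (simp_all add: islimpt_UNIV)
  moreover have "(\<lambda>t::real. u + t *\<^sub>R (a - u)) -` U \<subseteq> {t. poly P t = 0}"
    using neg P by auto
  ultimately show False using fin finite_subset by blast
qed

text \<open>Plays the part of the integral domain property, and is used to find points that are
  generic for several polynomials at once.\<close>

lemma real_polynomial_function_mult_nonzero:
  fixes p :: "'a::real_normed_vector \<Rightarrow> real"
  assumes p: "real_polynomial_function p" "p a \<noteq> 0" and q: "real_polynomial_function q" "q b \<noteq> 0"
  shows "\<exists>x. p x * q x \<noteq> 0"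
proof -
  have "open {x. p x \<noteq> 0}"
    by (intro open_Collect_neq real_polynomial_function_continuous_on p(1) continuous_on_const)
  then obtain x where "p x \<noteq> 0" "q x \<noteq> 0"
    using real_polynomial_function_nonzero_dense[OF q, of "{x. p x \<noteq> 0}"] p(2) by auto
  then show ?thesis by auto
qed

lemma real_polynomial_function_has_derivative:
  fixes p :: "'a::real_normed_vector \<Rightarrow> real"
  assumes "real_polynomial_function p"
  shows "\<exists>p'. (\<forall>x. (p has_derivative p' x) (at x)) \<and> (\<forall>v. real_polynomial_function (\<lambda>x. p' x v))"
  using assms
proof (induction p rule: real_polynomial_function.induct)
  case (linear f)
  then show ?case
    by (intro exI[of _ "\<lambda>x. f"]) (auto intro: bounded_linear_imp_has_derivative)
next
  case (const c)
  show ?case by (intro exI[of _ "\<lambda>x v. 0"]) auto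
next
  case (add f g)
  then obtain f' g' where
      "\<forall>x. (f has_derivative f' x) (at x)" "\<forall>v. real_polynomial_function (\<lambda>x. f' x v)"
      "\<forall>x. (g has_derivative g' x) (at x)" "\<forall>v. real_polynomial_function (\<lambda>x. g' x v)"
    by blast
  then show ?case
    by (intro exI[of _ "\<lambda>x v. f' x v + g' x v"]) (auto intro!: derivative_intros)
next
  case (mult f g)
  then obtain f' g' where
      "\<forall>x. (f has_derivative f' x) (at x)" "\<forall>v. real_polynomial_function (\<lambda>x. f' x v)"
      "\<forall>x. (g has_derivative g' x) (at x)" "\<forall>v. real_polynomial_function (\<lambda>x. g' x v)"
    by blast
  then show ?case using mult.hyps
    by (intro exI[of _ "\<lambda>x v. f x * g' x v + f' x v * g x"])
       (auto intro!: derivative_intros real_polynomial_function.intros(3,4))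
qed

lemma has_real_derivative_along_line:
  fixes f :: "'a::real_normed_vector \<Rightarrow> real"
  assumes "\<And>x. (f has_derivative f' x) (at x)"
  shows "((\<lambda>s. f (x + s *\<^sub>R v)) has_real_derivative f' (x + s *\<^sub>R v) v) (at s)"
proof -
  have "((\<lambda>s. x + s *\<^sub>R v) has_derivative (\<lambda>s. s *\<^sub>R v)) (at s)"
    by (auto intro!: derivative_eq_intros)
  then have "((\<lambda>s. f (x + s *\<^sub>R v)) has_derivative (\<lambda>t. f' (x + s *\<^sub>R v) (t *\<^sub>R v))) (at s)"
    by (rule has_derivative_compose) (rule assms)
  moreover have "linear (f' (x + s *\<^sub>R v))"
    using assms has_derivative_linear by blast
  ultimately show ?thesis
    by (simp add: has_field_derivative_def linear_scale mult_commute_abs)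
qed

lemma real_polynomial_function_nth: "real_polynomial_function (\<lambda>x::real^'n::finite. x $ i)"
  by (intro real_polynomial_function.intros(1) bounded_linear_vec_nth)

lemma real_polynomial_function_mmonom: "real_polynomial_function (mmonom \<alpha>)"
  unfolding mmonom_def
  by (intro real_polynomial_function_prod real_polynomial_function_power
      real_polynomial_function_nth) simp

lemma real_polynomial_function_mpoly_eval: "is_mpoly c \<Longrightarrow> real_polynomial_function (mpoly_eval c)"
  unfolding mpoly_eval_def is_mpoly_def
  by (intro real_polynomial_function_sum real_polynomial_function.intros(2,4)
      real_polynomial_function_mmonom) simp

section \<open>Monomials and coefficient functions\<close>

lemma mmonom_add: "mmonom (\<lambda>i. \<alpha> i + \<beta> i) x = mmonom \<alpha> x * mmonom \<beta> x"
  by (simp add: mmonom_def power_add prod.distrib)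

lemma mdeg_add: "mdeg (\<lambda>i. \<alpha> i + \<beta> i) = mdeg \<alpha> + mdeg \<beta>"
  by (simp add: mdeg_def sum.distrib)

lemma mmonom_zero [simp]: "mmonom (\<lambda>i. 0) x = 1"
  by (simp add: mmonom_def)

lemma mdeg_eq_0_iff: "mdeg \<alpha> = 0 \<longleftrightarrow> \<alpha> = (\<lambda>i. 0)"
  by (auto simp: mdeg_def)

lemma mmonom_scaleR: "mmonom \<alpha> (t *\<^sub>R x) = t ^ mdeg \<alpha> * mmonom \<alpha> x"
  by (simp add: mmonom_def mdeg_def power_mult_distrib prod.distrib power_sum)

lemma finite_mdeg_le: "finite {\<alpha>::'n::finite \<Rightarrow> nat. mdeg \<alpha> \<le> k}"
proof (rule finite_subset)
  show "{\<alpha>::'n \<Rightarrow> nat. mdeg \<alpha> \<le> k} \<subseteq> PiE UNIV (\<lambda>_. {..k})"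
  proof
    fix \<alpha> :: "'n \<Rightarrow> nat" assume "\<alpha> \<in> {\<alpha>. mdeg \<alpha> \<le> k}"
    moreover have "\<alpha> i \<le> mdeg \<alpha>" for i
      unfolding mdeg_def by (intro member_le_sum) auto
    ultimately show "\<alpha> \<in> PiE UNIV (\<lambda>_. {..k})" by (auto intro: order_trans)
  qed
qed (intro finite_PiE; simp)

lemma mpoly_eval_eq_sum:
  assumes "finite S" "\<And>\<alpha>. c \<alpha> \<noteq> 0 \<Longrightarrow> \<alpha> \<in> S"
  shows "mpoly_eval c x = (\<Sum>\<alpha>\<in>S. c \<alpha> * mmonom \<alpha> x)"
  unfolding mpoly_eval_def using assms by (intro sum.mono_neutral_left) auto

lemma is_mpolyI: "finite S \<Longrightarrow> (\<And>\<alpha>. c \<alpha> \<noteq> 0 \<Longrightarrow> \<alpha> \<in> S) \<Longrightarrow> is_mpoly c"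
  unfolding is_mpoly_def by (rule finite_subset[of _ S]) auto

text \<open>The exponents \<open>\<alpha> a\<close> may repeat, as they do when two polynomials are
  multiplied out; each coefficient collects the fibre of its exponent.\<close>

lemma is_mpoly_of_sum:
  assumes "finite A"
  shows "\<exists>c. is_mpoly c \<and> (\<forall>x. mpoly_eval c x = (\<Sum>a\<in>A. r a * mmonom (\<alpha> a) x))"
proof -
  define c where "c = (\<lambda>\<beta>. \<Sum>a\<in>{a\<in>A. \<alpha> a = \<beta>}. r a)"
  have c: "c \<beta> \<noteq> 0 \<Longrightarrow> \<beta> \<in> \<alpha> ` A" for \<beta>
    unfolding c_def by (rule ccontr) (auto intro!: sum.neutral)
  have "mpoly_eval c x = (\<Sum>a\<in>A. r a * mmonom (\<alpha> a) x)" for x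
  proof -
    have "mpoly_eval c x = (\<Sum>\<beta>\<in>\<alpha> ` A. c \<beta> * mmonom \<beta> x)"
      using assms c by (intro mpoly_eval_eq_sum) auto
    also have "\<dots> = (\<Sum>\<beta>\<in>\<alpha> ` A. \<Sum>a\<in>{a\<in>A. \<alpha> a = \<beta>}. r a * mmonom (\<alpha> a) x)"
      by (intro sum.cong) (auto simp: c_def sum_distrib_right intro!: sum.cong)
    also have "\<dots> = (\<Sum>a\<in>A. r a * mmonom (\<alpha> a) x)"
      using assms by (rule sum.image_gen[symmetric])
    finally show ?thesis .
  qed
  moreover have "is_mpoly c" using c assms by (intro is_mpolyI[of "\<alpha> ` A"]) auto
  ultimately show ?thesis by blast
qed

lemma linear_axis_expansion:
  fixes f :: "real^'n::finite \<Rightarrow> real"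
  assumes "linear f"
  shows "f x = (\<Sum>i\<in>UNIV. x $ i * f (axis i 1))"
proof -
  have "f x = f (\<Sum>i\<in>UNIV. x $ i *\<^sub>R axis i 1)"
    by (simp add: basis_expansion[of x, simplified scalar_mult_eq_scaleR])
  also have "\<dots> = (\<Sum>i\<in>UNIV. x $ i * f (axis i 1))"
    using assms by (simp add: linear_sum linear_scale)
  finally show ?thesis .
qed

text \<open>The ideal hypothesis speaks of coefficient functions, the analysis of polynomial
  functions; this direction carries a function back into the ideal.\<close>

lemma real_polynomial_function_imp_mpoly:
  fixes p :: "real^'n::finite \<Rightarrow> real"
  assumes "real_polynomial_function p"
  shows "\<exists>c. is_mpoly c \<and> (\<forall>x. mpoly_eval c x = p x)"
  using assms
proof (induction p rule: real_polynomial_function.induct)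
  case (linear f)
  have "f x = (\<Sum>i\<in>UNIV. f (axis i 1) * mmonom (\<lambda>j. if j = i then 1 else 0) x)" for x
  proof -
    have "f x = (\<Sum>i\<in>UNIV. x $ i * f (axis i 1))"
      by (rule linear_axis_expansion[OF bounded_linear.linear[OF linear]])
    also have "\<dots> = (\<Sum>i\<in>UNIV. f (axis i 1) * mmonom (\<lambda>j. if j = i then 1 else 0) x)"
    proof (intro sum.cong refl)
      fix i
      have "mmonom (\<lambda>j. if j = i then 1 else 0) x = (\<Prod>j\<in>UNIV. if j = i then x $ j else 1)"
        unfolding mmonom_def by (intro prod.cong) auto
      then show "x $ i * f (axis i 1) = f (axis i 1) * mmonom (\<lambda>j. if j = i then 1 else 0) x"
        by simp
    qed
    finally show ?thesis .
  qed
  note f_eq = this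
  obtain c where c: "is_mpoly c"
    "\<forall>x. mpoly_eval c x = (\<Sum>i\<in>UNIV. f (axis i 1) * mmonom (\<lambda>j. if j = i then 1 else 0) x)"
    using is_mpoly_of_sum[OF finite[of "UNIV::'n set"], of "\<lambda>i. f (axis i 1)" "\<lambda>i j. if j = i then 1 else 0"]
    by blast
  have "mpoly_eval c x = f x" for x
    unfolding c(2)[rule_format] by (rule f_eq[symmetric])
  then show ?case using c(1) by blast
next
  case (const c)
  with is_mpoly_of_sum[of "{()}" "\<lambda>_. c" "\<lambda>_ _. 0"]
  show ?case by simp
next
  case (add f g)
  then obtain c e where c: "is_mpoly c" "\<forall>x. mpoly_eval c x = f x"
    and e: "is_mpoly e" "\<forall>x. mpoly_eval e x = g x" by blast
  let ?A = "{\<alpha>. c \<alpha> \<noteq> 0} \<union> {\<alpha>. e \<alpha> \<noteq> 0}"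
  have fin: "finite ?A" using c e by (auto simp: is_mpoly_def)
  have "f x + g x = (\<Sum>\<alpha>\<in>?A. (c \<alpha> + e \<alpha>) * mmonom \<alpha> x)" for x
    using mpoly_eval_eq_sum[OF fin, of c x] mpoly_eval_eq_sum[OF fin, of e x] c e
    by (simp add: distrib_right sum.distrib)
  with is_mpoly_of_sum[OF fin, of "\<lambda>\<alpha>. c \<alpha> + e \<alpha>" "\<lambda>\<alpha>. \<alpha>"]
  show ?case by simp
next
  case (mult f g)
  then obtain c e where c: "is_mpoly c" "\<forall>x. mpoly_eval c x = f x"
    and e: "is_mpoly e" "\<forall>x. mpoly_eval e x = g x" by blast
  let ?A = "{\<alpha>. c \<alpha> \<noteq> 0}" and ?B = "{\<alpha>. e \<alpha> \<noteq> 0}"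
  have fin: "finite (?A \<times> ?B)" using c e by (auto simp: is_mpoly_def)
  have "f x * g x = (\<Sum>(\<alpha>,\<beta>)\<in>?A \<times> ?B. (c \<alpha> * e \<beta>) * mmonom (\<lambda>i. \<alpha> i + \<beta> i) x)" for x
  proof -
    have "f x * g x = mpoly_eval c x * mpoly_eval e x" using c(2) e(2) by simp
    also have "\<dots> = (\<Sum>\<alpha>\<in>?A. \<Sum>\<beta>\<in>?B. (c \<alpha> * e \<beta>) * mmonom (\<lambda>i. \<alpha> i + \<beta> i) x)"
      unfolding mpoly_eval_def sum_product by (intro sum.cong refl) (simp add: mmonom_add)
    also have "\<dots> = (\<Sum>(\<alpha>,\<beta>)\<in>?A \<times> ?B. (c \<alpha> * e \<beta>) * mmonom (\<lambda>i. \<alpha> i + \<beta> i) x)"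
      by (rule sum.cartesian_product)
    finally show ?thesis .
  qed
  with is_mpoly_of_sum[OF fin, of "\<lambda>(\<alpha>,\<beta>). c \<alpha> * e \<beta>" "\<lambda>(\<alpha>,\<beta>). (\<lambda>i. \<alpha> i + \<beta> i)"]
  show ?case by (simp add: case_prod_unfold)
qed

text \<open>Induction on a set \<open>T\<close> containing all variables that occur. Setting the
  variable \<open>k\<close> to t turns the sum into a univariate polynomial that vanishes
  identically; its coefficient at \<open>\<alpha> k\<close> is a vanishing sum over the exponents
  sharing that entry, in which \<open>k\<close> no longer occurs.\<close>

lemma mmonom_independent_aux:
  fixes c :: "('n::finite \<Rightarrow> nat) \<Rightarrow> real"
  assumes "finite T" "finite S" "\<And>\<alpha> i. \<alpha> \<in> S \<Longrightarrow> i \<notin> T \<Longrightarrow> \<alpha> i = 0"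
    "\<And>x. (\<Sum>\<alpha>\<in>S. c \<alpha> * mmonom \<alpha> x) = 0" "\<alpha> \<in> S"
  shows "c \<alpha> = 0"
  using assms
proof (induction T arbitrary: S c \<alpha> rule: finite_induct)
  case empty
  then have "\<beta> = (\<lambda>i. 0)" if "\<beta> \<in> S" for \<beta> using that by auto
  with empty(4) have "S = {\<alpha>}" "\<alpha> = (\<lambda>i. 0)" by blast+
  with empty(3)[of 0] show ?case by simp
next
  case (insert k T)
  \<comment> \<open>Within the slice the entry at \<open>k\<close> is always
    \<open>\<alpha> k\<close>, so erasing it is injective and \<open>c'\<close> can restore
    it.\<close>
  define S' where "S' = (\<lambda>\<beta>. \<beta>(k := 0)) ` {\<beta>\<in>S. \<beta> k = \<alpha> k}"
  define c' where "c' = (\<lambda>\<beta>. c (\<beta>(k := \<alpha> k)))"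
  have inj: "inj_on (\<lambda>\<beta>. \<beta>(k := 0)) {\<beta>\<in>S. \<beta> k = \<alpha> k}"
  proof (rule inj_onI)
    fix \<beta> \<gamma> assume "\<beta> \<in> {\<beta>\<in>S. \<beta> k = \<alpha> k}" "\<gamma> \<in> {\<beta>\<in>S. \<beta> k = \<alpha> k}" "\<beta>(k := 0) = \<gamma>(k := 0)"
    then show "\<beta> = \<gamma>" by (metis (mono_tags, lifting) fun_upd_triv fun_upd_upd mem_Collect_eq)
  qed
  have mm: "mmonom \<beta> (\<chi> j. if j = k then t else x $ j) = t ^ \<beta> k * mmonom (\<beta>(k := 0)) x" for \<beta> t x
  proof -
    have "mmonom \<beta> (\<chi> j. if j = k then t else x $ j)
        = t ^ \<beta> k * (\<Prod>j\<in>UNIV - {k}. (if j = k then t else x $ j) ^ \<beta> j)"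
      unfolding mmonom_def by (subst prod.remove[of UNIV k]) auto
    also have "(\<Prod>j\<in>UNIV - {k}. (if j = k then t else x $ j) ^ \<beta> j)
        = (\<Prod>j\<in>UNIV - {k}. (x $ j) ^ (\<beta>(k := 0)) j)"
      by (intro prod.cong) auto
    also have "\<dots> = mmonom (\<beta>(k := 0)) x"
      unfolding mmonom_def by (subst prod.remove[of UNIV k]) auto
    finally show ?thesis .
  qed
  have sum0: "(\<Sum>\<beta>\<in>S'. c' \<beta> * mmonom \<beta> x) = 0" for x
  proof -
    define P where "P = (\<Sum>\<beta>\<in>S. monom (c \<beta> * mmonom (\<beta>(k := 0)) x) (\<beta> k))"
    have "poly P t = 0" for t
      using insert.prems(3)[of "\<chi> j. if j = k then t else x $ j"]
      by (simp add: P_def poly_sum poly_monom mm mult_ac)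
    then have "P = 0" using poly_all_0_iff_0 by blast
    then have "coeff P (\<alpha> k) = 0" by simp
    then have "(\<Sum>\<beta>\<in>{\<beta>\<in>S. \<beta> k = \<alpha> k}. c \<beta> * mmonom (\<beta>(k := 0)) x) = 0"
      using insert.prems(1) by (simp add: P_def coeff_sum sum.inter_filter)
    moreover have "(\<Sum>\<beta>\<in>S'. c' \<beta> * mmonom \<beta> x)
        = (\<Sum>\<beta>\<in>{\<beta>\<in>S. \<beta> k = \<alpha> k}. c \<beta> * mmonom (\<beta>(k := 0)) x)"
      unfolding S'_def sum.reindex[OF inj] c'_def
      by (intro sum.cong refl) (auto, metis fun_upd_triv)
    ultimately show ?thesis by simp
  qed
  have "c' (\<alpha>(k := 0)) = 0"
  proof (rule insert.IH[of S'])
    show "finite S'" using insert.prems(1) by (simp add: S'_def)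
    show "\<beta> i = 0" if "\<beta> \<in> S'" "i \<notin> T" for \<beta> i
      using that insert.prems(2) unfolding S'_def by (cases "i = k") auto
    show "\<alpha>(k := 0) \<in> S'" using insert.prems(4) by (auto simp: S'_def)
  qed (rule sum0)
  then show ?case by (simp add: c'_def)
qed

lemma mmonom_independent:
  fixes c :: "('n::finite \<Rightarrow> nat) \<Rightarrow> real"
  assumes "finite S" "\<And>x. (\<Sum>\<alpha>\<in>S. c \<alpha> * mmonom \<alpha> x) = 0" "\<alpha> \<in> S"
  shows "c \<alpha> = 0"
  by (rule mmonom_independent_aux[of UNIV S]) (use assms in auto)

section \<open>Coprimality of a radical generator and its partial derivatives\<close>

definition vec_upd :: "real^'n::finite \<Rightarrow> 'n \<Rightarrow> real \<Rightarrow> real^'n" where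
  "vec_upd x i t = (\<chi> j. if j = i then t else x $ j)"

lemma vec_upd_nth [simp]: "vec_upd x i t $ j = (if j = i then t else x $ j)"
  by (simp add: vec_upd_def)

lemma vec_upd_upd [simp]: "vec_upd (vec_upd x i s) i t = vec_upd x i t"
  by (simp add: vec_eq_iff)

lemma vec_upd_triv [simp]: "vec_upd x i (x $ i) = x"
  by (simp add: vec_eq_iff)

lemma vec_upd_eq: "vec_upd x i t = vec_upd x i 0 + t *\<^sub>R axis i 1"
  by (simp add: vec_eq_iff axis_def)

lemma vec_upd_eq_add: "vec_upd x i t = x + (t - x $ i) *\<^sub>R axis i 1"
  by (simp add: vec_eq_iff axis_def)

text \<open>The polynomial in the variable \<open>i\<close> whose coefficients are polynomials in
  the others, with those evaluated at \<open>x\<close>. A real polynomial is determined by its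
  values, so the description is unique whenever such a polynomial exists.\<close>

definition coord_poly :: "'n::finite \<Rightarrow> (real^'n \<Rightarrow> real) \<Rightarrow> real^'n \<Rightarrow> real poly" where
  "coord_poly i p x = (THE P. \<forall>t. poly P t = p (vec_upd x i t))"

lemma coord_poly_eqI:
  assumes "\<And>t. poly P t = p (vec_upd x i t)"
  shows "coord_poly i p x = P"
  unfolding coord_poly_def
proof (rule the_equality)
  fix Q :: "real poly" assume "\<forall>t. poly Q t = p (vec_upd x i t)"
  then have "poly Q = poly P" using assms by auto
  then show "Q = P" using poly_eq_poly_eq_iff by blast
qed (use assms in auto)

text \<open>A family \<open>L\<close> is built by induction because \<open>coord_poly\<close>, given
  by a description, does not follow the structure of \<open>p\<close>. The degree bound has to be
  uniform in \<open>x\<close>, since the degree at a single point may be smaller.\<close>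

lemma coord_poly_aux:
  fixes p :: "real^'n::finite \<Rightarrow> real"
  assumes "real_polynomial_function p"
  shows "\<exists>L N. (\<forall>x t. poly (L x) t = p (vec_upd x i t)) \<and> (\<forall>x. degree (L x) < N)
    \<and> (\<forall>j. real_polynomial_function (\<lambda>x. coeff (L x) j))"
  using assms
proof (induction p rule: real_polynomial_function.induct)
  case (linear f)
  note bl = linear
  then interpret bounded_linear f .
  let ?L = "\<lambda>x. [:f (vec_upd x i 0), f (axis i 1):]"
  have "bounded_linear (\<lambda>x. f (vec_upd x i 0))"
    by (intro bounded_linear_compose[OF bl] linear_conv_bounded_linear[THEN iffD1] linearI)
       (simp_all add: vec_eq_iff)
  then have "real_polynomial_function (\<lambda>x. coeff (?L x) j)" for j
    by (cases j; cases "j - 1") (auto simp: coeff_pCons)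
  moreover have "poly (?L x) t = f (vec_upd x i t)" for x t
    using arg_cong[OF vec_upd_eq[of x i t], of f] by (simp add: add scaleR)
  moreover have "degree (?L x) < 2" for x by simp
  ultimately show ?case by (intro exI[of _ ?L] exI[of _ 2]) simp
next
  case (const c)
  have "real_polynomial_function (\<lambda>x::real^'n. coeff [:c:] j)" for j ..
  then show ?case by (intro exI[of _ "\<lambda>x. [:c:]"] exI[of _ 1]) simp
next
  case (add f g)
  then obtain L M K N where
      L: "\<forall>x t. poly (L x) t = f (vec_upd x i t)" "\<forall>x. degree (L x) < K"
        "\<forall>j. real_polynomial_function (\<lambda>x. coeff (L x) j)"
      and M: "\<forall>x t. poly (M x) t = g (vec_upd x i t)" "\<forall>x. degree (M x) < N"
        "\<forall>j. real_polynomial_function (\<lambda>x. coeff (M x) j)"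
    by blast
  have "degree (L x + M x) < max K N" for x
    using L(2) M(2) by (intro degree_add_less) (simp_all add: less_max_iff_disj)
  then show ?case using L M
    by (intro exI[of _ "\<lambda>x. L x + M x"] exI[of _ "max K N"]) auto
next
  case (mult f g)
  then obtain L M K N where
      L: "\<forall>x t. poly (L x) t = f (vec_upd x i t)" "\<forall>x. degree (L x) < K"
        "\<forall>j. real_polynomial_function (\<lambda>x. coeff (L x) j)"
      and M: "\<forall>x t. poly (M x) t = g (vec_upd x i t)" "\<forall>x. degree (M x) < N"
        "\<forall>j. real_polynomial_function (\<lambda>x. coeff (M x) j)"
    by blast
  have "degree (L x * M x) < K + N" for x
    using degree_mult_le[of "L x" "M x"] L(2)[rule_format, of x] M(2)[rule_format, of x] by linarith
  then show ?case using L M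
    by (intro exI[of _ "\<lambda>x. L x * M x"] exI[of _ "K + N"])
       (auto simp: coeff_mult intro!: real_polynomial_function_sum real_polynomial_function.intros(4))
qed

context
  fixes i :: "'n::finite"
begin

lemma poly_coord_poly:
  assumes "real_polynomial_function p"
  shows "poly (coord_poly i p x) t = p (vec_upd x i t)"
proof -
  obtain L where L: "\<forall>x t. poly (L x) t = p (vec_upd x i t)"
    using coord_poly_aux[OF assms, of i] by blast
  then have "coord_poly i p x = L x" by (intro coord_poly_eqI) auto
  then show ?thesis using L by simp
qed

lemma poly_coord_poly_self:
  "real_polynomial_function p \<Longrightarrow> poly (coord_poly i p x) (x $ i) = p x"
  by (simp add: poly_coord_poly)

lemma coord_poly_bounded:
  assumes "real_polynomial_function p"
  shows "\<exists>N. \<forall>x. degree (coord_poly i p x) < N"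
proof -
  obtain L N where "\<forall>x t. poly (L x) t = p (vec_upd x i t)" and L: "\<forall>x. degree (L x) < N"
    using coord_poly_aux[OF assms, of i] by blast
  then have "coord_poly i p x = L x" for x by (intro coord_poly_eqI) auto
  then show ?thesis using L by auto
qed

lemma real_polynomial_function_coord_coeff:
  assumes "real_polynomial_function p"
  shows "real_polynomial_function (\<lambda>x. coeff (coord_poly i p x) j)"
proof -
  obtain L where "\<forall>x t. poly (L x) t = p (vec_upd x i t)"
     and L: "\<forall>j. real_polynomial_function (\<lambda>x. coeff (L x) j)"
    using coord_poly_aux[OF assms, of i] by blast
  then have "coord_poly i p x = L x" for x by (intro coord_poly_eqI) auto
  then show ?thesis using L by simp
qed

lemma coord_poly_vec_upd: "coord_poly i p (vec_upd x i t) = coord_poly i p x"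
  by (simp add: coord_poly_def)

lemma coord_poly_mult:
  "real_polynomial_function p \<Longrightarrow> real_polynomial_function q \<Longrightarrow>
   coord_poly i (\<lambda>x. p x * q x) x = coord_poly i p x * coord_poly i q x"
  by (intro coord_poly_eqI) (simp add: poly_coord_poly)

lemma coord_poly_diff:
  "real_polynomial_function p \<Longrightarrow> real_polynomial_function q \<Longrightarrow>
   coord_poly i (\<lambda>x. p x - q x) x = coord_poly i p x - coord_poly i q x"
  by (intro coord_poly_eqI) (simp add: poly_coord_poly)

lemma coord_poly_indep:
  "(\<And>x t. p (vec_upd x i t) = p x) \<Longrightarrow> coord_poly i p x = [:p x:]"
  by (intro coord_poly_eqI) simp

lemma coord_poly_nth_power: "coord_poly i (\<lambda>x. (x $ i) ^ k) x = monom 1 k"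
  by (intro coord_poly_eqI) (simp add: poly_monom)

lemma coord_poly_derivative:
  assumes p: "real_polynomial_function p" and p': "\<And>x. (p has_derivative p' x) (at x)"
  shows "coord_poly i (\<lambda>x. p' x (axis i 1)) x = pderiv (coord_poly i p x)"
proof (rule coord_poly_eqI)
  fix t
  have "((\<lambda>t. vec_upd x i t) has_derivative (\<lambda>t. t *\<^sub>R axis i 1)) (at t)"
    unfolding vec_upd_eq_add[of x i] by (auto intro!: derivative_eq_intros)
  then have "((\<lambda>t. p (vec_upd x i t)) has_derivative (\<lambda>s. p' (vec_upd x i t) (s *\<^sub>R axis i 1))) (at t)"
    by (rule has_derivative_compose) (rule p')
  moreover have "linear (p' (vec_upd x i t))"
    using p' has_derivative_linear by blast
  ultimately have "((\<lambda>t. p (vec_upd x i t)) has_real_derivative p' (vec_upd x i t) (axis i 1)) (at t)"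
    by (simp add: has_field_derivative_def linear_scale mult_commute_abs)
  moreover have "((\<lambda>t. p (vec_upd x i t)) has_real_derivative poly (pderiv (coord_poly i p x)) t) (at t)"
    using poly_DERIV[of "coord_poly i p x" t] by (simp add: poly_coord_poly[OF p])
  ultimately show "poly (pderiv (coord_poly i p x)) t = p' (vec_upd x i t) (axis i 1)"
    using DERIV_unique by blast
qed

text \<open>Strict, so that the bound 0 characterises the zero polynomial, and uniform in
  \<open>x\<close>, since the leading coefficient may vanish at some points.\<close>

definition coord_degree_less :: "nat \<Rightarrow> (real^'n \<Rightarrow> real) \<Rightarrow> bool" where
  "coord_degree_less N p \<longleftrightarrow> (\<forall>x. \<forall>j\<ge>N. coeff (coord_poly i p x) j = 0)"

lemma coord_degree_less_0:
  assumes "real_polynomial_function p" "coord_degree_less 0 p"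
  shows "p x = 0"
proof -
  have "coord_poly i p x = 0" using assms(2) by (simp add: coord_degree_less_def poly_eq_iff)
  then show ?thesis using poly_coord_poly_self[OF assms(1), of x] by simp
qed

lemma coord_degree_less_ex: 
  assumes "real_polynomial_function p" shows "\<exists>N. coord_degree_less N p"
proof -
  obtain N where "\<forall>x. degree (coord_poly i p x) < N" using coord_poly_bounded[OF assms] ..
  then have "coord_degree_less N p" 
    by (meson coeff_eq_0 coord_degree_less_def order_less_le_trans)
  then show ?thesis ..
qed

text \<open>The coefficients form no field, so the leading coefficient \<open>c\<close> of
  \<open>g\<close> cannot be inverted; a power of it multiplies \<open>f\<close> instead. Each round
  lowers the degree bound \<open>M\<close> of \<open>f\<close> by one.\<close>

lemma pseudo_division:
  fixes g f :: "real^'n \<Rightarrow> real"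
  assumes g: "real_polynomial_function g" "coord_degree_less (Suc e) g"
    and f: "real_polynomial_function f" "coord_degree_less M f"
  defines "c \<equiv> \<lambda>x. coeff (coord_poly i g x) e"
  shows "\<exists>k u. real_polynomial_function u \<and> coord_degree_less e (\<lambda>x. c x ^ k * f x - g x * u x)"
  using f
proof (induction M arbitrary: f)
  case 0
  have "coord_degree_less e f" using 0 by (simp add: coord_degree_less_def)
  then show ?case by (intro exI[of _ 0] exI[of _ "\<lambda>x. 0"]) auto
next
  case (Suc M)
  show ?case
  proof (cases "M < e")
    case True
    then have "coord_degree_less e f" using Suc.prems by (simp add: coord_degree_less_def)
    then show ?thesis by (intro exI[of _ 0] exI[of _ "\<lambda>x. 0"]) auto
  next
    case False
    define a where "a = (\<lambda>x. coeff (coord_poly i f x) M)"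
    define m where "m = (\<lambda>x::real^'n. a x * (x $ i) ^ (M - e))"
    \<comment> \<open>The factor \<open>m\<close> is chosen so that the coefficients at
      \<open>M\<close> cancel: both products contribute \<open>c x * a x\<close> there.\<close>
    define f1 where "f1 = (\<lambda>x. c x * f x - m x * g x)"
    have pc: "real_polynomial_function c" and pa: "real_polynomial_function a"
      unfolding c_def a_def
      using real_polynomial_function_coord_coeff g Suc.prems by auto
    have pow: "real_polynomial_function (\<lambda>x::real^'n. (x $ i) ^ (M - e))"
      by (intro real_polynomial_function_power real_polynomial_function_nth)
    then have pm: "real_polynomial_function m" unfolding m_def using pa by auto
    have pf1: "real_polynomial_function f1"
      unfolding f1_def using pc pm g Suc.prems by auto
    have "coord_poly i f1 x = [:c x:] * coord_poly i f x
        - [:a x:] * monom 1 (M - e) * coord_poly i g x" for x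
    proof -
      have "coord_poly i c x = [:c x:]" "coord_poly i a x = [:a x:]"
        by (auto simp: c_def a_def coord_poly_vec_upd intro!: coord_poly_indep)
      then show ?thesis
        using pc pa pow pm g Suc.prems unfolding f1_def m_def
        by (simp add: coord_poly_diff coord_poly_mult coord_poly_nth_power
            real_polynomial_function.intros(4))
    qed
    then have cf: "coeff (coord_poly i f1 x) j = c x * coeff (coord_poly i f x) j
        - a x * (if j < M - e then 0 else coeff (coord_poly i g x) (j - (M - e)))" for x j
      by (simp add: coeff_monom_mult mult.assoc)
    have "coord_degree_less M f1"
      unfolding coord_degree_less_def
    proof (intro allI impI)
      fix x j assume j: "M \<le> j"
      show "coeff (coord_poly i f1 x) j = 0"
      proof (cases "j = M")
        case True then show ?thesis using False unfolding cf by (simp add: c_def a_def)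
      next
        case ne: False
        then have "coeff (coord_poly i f x) j = 0" "coeff (coord_poly i g x) (j - (M - e)) = 0"
          using Suc.prems g j False unfolding coord_degree_less_def by auto
        then show ?thesis unfolding cf by simp
      qed
    qed
    from Suc.IH[OF pf1 this] obtain k u where u: "real_polynomial_function u"
      and k: "coord_degree_less e (\<lambda>x. c x ^ k * f1 x - g x * u x)" by blast
    have "c x ^ k * f1 x - g x * u x = c x ^ Suc k * f x - g x * (u x + c x ^ k * m x)" for x
      by (simp add: f1_def algebra_simps)
    with k have "coord_degree_less e (\<lambda>x. c x ^ Suc k * f x - g x * (u x + c x ^ k * m x))" by simp
    moreover have "real_polynomial_function (\<lambda>x. u x + c x ^ k * m x)"
      using u pc pm by (intro real_polynomial_function.intros(3,4) real_polynomial_function_power)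
    ultimately show ?thesis by (intro exI[of _ "Suc k"] exI[of _ "\<lambda>x. u x + c x ^ k * m x"]) simp
  qed
qed

text \<open>Here \<open>e\<close> is the generic degree in the variable \<open>i\<close>: the
  coefficient at \<open>e\<close> is nonzero somewhere, though not everywhere.\<close>

lemma least_coord_degree:
  assumes "real_polynomial_function g" "g a \<noteq> 0"
  obtains e b where "coord_degree_less (Suc e) g" "coeff (coord_poly i g b) e \<noteq> 0"
    "\<And>N. coord_degree_less N g \<Longrightarrow> e < N"
proof -
  define N where "N = (LEAST N. coord_degree_less N g)"
  have N: "coord_degree_less N g"
    unfolding N_def using coord_degree_less_ex[OF assms(1)] by (rule LeastI_ex)
  have "N \<noteq> 0" using coord_degree_less_0[OF assms(1)] N assms(2) by metis
  then obtain e where e: "N = Suc e" using not0_implies_Suc by blast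
  have le: "e < M" if "coord_degree_less M g" for M
    using Least_le[of "\<lambda>N. coord_degree_less N g", OF that] e N_def by simp
  have "\<exists>b. coeff (coord_poly i g b) e \<noteq> 0"
  proof (rule ccontr)
    assume "\<nexists>b. coeff (coord_poly i g b) e \<noteq> 0"
    then have "coord_degree_less e g" using N unfolding e coord_degree_less_def
      by (metis le_antisym not_less_eq_eq)
    then show False using le by blast
  qed
  then show ?thesis using that N le e by blast
qed

text \<open>If \<open>h\<close> generates a radical ideal then \<open>h\<close> and its \<open>i\<close>-th partial derivative are coprime as
  polynomials in the \<open>i\<close>-th variable: an element \<open>g\<close> of least degree in the ideal they generate
  divides \<open>h\<close> up to a factor not depending on that variable, and the cofactor of \<open>g\<close>, of smaller
  degree than \<open>h\<close>, would vanish wherever \<open>h\<close> does.\<close>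

lemma radical_generator_discriminant:
  fixes h :: "real^'n \<Rightarrow> real"
  assumes h: "real_polynomial_function h" "h a \<noteq> 0"
    and h': "\<And>x. (h has_derivative h' x) (at x)" "real_polynomial_function (\<lambda>x. h' x (axis i 1))"
    and gen: "\<And>p. real_polynomial_function p \<Longrightarrow> (\<And>x. h x = 0 \<Longrightarrow> p x = 0) \<Longrightarrow>
       \<exists>q. real_polynomial_function q \<and> (\<forall>x. p x = h x * q x)"
  shows "\<exists>R b. real_polynomial_function R \<and> R b \<noteq> 0 \<and> (\<forall>x t. R (vec_upd x i t) = R x) \<and>
     (\<forall>x. h x = 0 \<and> h' x (axis i 1) = 0 \<longrightarrow> R x = 0)"
proof -
  define hi where "hi = (\<lambda>x. h' x (axis i 1))"
  have phi: "real_polynomial_function hi" using h'(2) by (simp add: hi_def)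
  define J where "J = {p. \<exists>u v. real_polynomial_function u \<and> real_polynomial_function v \<and>
    p = (\<lambda>x. u x * h x + v x * hi x)}"
  have J_poly: "real_polynomial_function p" if "p \<in> J" for p
    using that h phi unfolding J_def by auto
  have hJ: "h \<in> J" unfolding J_def
    by (intro CollectI exI[of _ "\<lambda>x. 1"] exI[of _ "\<lambda>x. 0"]) auto
  have hiJ: "hi \<in> J" unfolding J_def
    by (intro CollectI exI[of _ "\<lambda>x. 0"] exI[of _ "\<lambda>x. 1"]) auto
  have J_comb: "(\<lambda>x. r x * p x - q x * s x) \<in> J"
    if "p \<in> J" "q \<in> J" "real_polynomial_function r" "real_polynomial_function s" for p q r s
  proof -
    from that obtain u v u' v' where *: "real_polynomial_function u" "real_polynomial_function v"
      "p = (\<lambda>x. u x * h x + v x * hi x)" "real_polynomial_function u'" "real_polynomial_function v'"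
      "q = (\<lambda>x. u' x * h x + v' x * hi x)" unfolding J_def by blast
    show ?thesis unfolding J_def
      using * that(3,4)
      by (intro CollectI exI[of _ "\<lambda>x. r x * u x - s x * u' x"] exI[of _ "\<lambda>x. r x * v x - s x * v' x"])
         (auto simp: algebra_simps fun_eq_iff)
  qed
  define N where "N = (LEAST N. \<exists>g\<in>J. (\<exists>x. g x \<noteq> 0) \<and> coord_degree_less N g)"
  have "\<exists>N. \<exists>g\<in>J. (\<exists>x. g x \<noteq> 0) \<and> coord_degree_less N g"
    using hJ h coord_degree_less_ex[OF h(1)] by blast
  then have "\<exists>g\<in>J. (\<exists>x. g x \<noteq> 0) \<and> coord_degree_less N g"
    unfolding N_def by (rule LeastI_ex)
  then obtain g z where gJ: "g \<in> J" and gz: "g z \<noteq> 0" and gN: "coord_degree_less N g" by blast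
  have N_min: "N \<le> M" if "p \<in> J" "p x \<noteq> 0" "coord_degree_less M p" for p x M
    unfolding N_def using that by (intro Least_le) blast
  note pg = J_poly[OF gJ]
  obtain e b where e: "coord_degree_less (Suc e) g" and b: "coeff (coord_poly i g b) e \<noteq> 0"
    and eN: "\<And>M. coord_degree_less M g \<Longrightarrow> e < M"
    using least_coord_degree[OF pg gz] by blast
  have e_min: "p x = 0" if "p \<in> J" "coord_degree_less e p" for p x
    using N_min[OF that(1) _ that(2)] eN[OF gN] by force
  show ?thesis
  \<comment> \<open>With \<open>e = 0\<close> the element \<open>g\<close> is free of the variable
    \<open>i\<close> and, being a combination of \<open>h\<close> and \<open>hi\<close>, vanishes at
    their common zeros, so it serves as \<open>R\<close>. The other case is contradictory.\<close>
  proof (cases "e = 0")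
    case True
    then have "degree (coord_poly i g x) \<le> 0" for x
      using e by (intro degree_le) (simp add: coord_degree_less_def)
    then have "degree (coord_poly i g x) = 0" for x by blast
    then have "g (vec_upd x i t) = g x" for x t
      using poly_coord_poly[OF pg, of x t] poly_coord_poly_self[OF pg, of x]
      by (metis degree_eq_zeroE mult_zero_right poly_0 poly_pCons)
    moreover have "g x = 0" if "h x = 0" "hi x = 0" for x
      using gJ that unfolding J_def by auto
    ultimately show ?thesis using pg gz unfolding hi_def by (intro exI[of _ g] exI[of _ z]) auto
  next
    case False
    define c where "c = (\<lambda>x. coeff (coord_poly i g x) e)"
    have pc: "real_polynomial_function c"
      unfolding c_def using real_polynomial_function_coord_coeff[OF pg] .
    have c_indep: "c (vec_upd x i t) = c x" for x t
      by (simp add: c_def coord_poly_vec_upd)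
    have div: "\<exists>k u. real_polynomial_function u \<and> (\<forall>x. c x ^ k * p x = g x * u x)" if pJ: "p \<in> J" for p
    proof -
      obtain M where "coord_degree_less M p" using coord_degree_less_ex[OF J_poly[OF pJ]] ..
      from pseudo_division[OF pg e J_poly[OF pJ] this] obtain k u
        where u: "real_polynomial_function u"
          and k: "coord_degree_less e (\<lambda>x. c x ^ k * p x - g x * u x)" unfolding c_def by blast
      have "(\<lambda>x. c x ^ k * p x - g x * u x) \<in> J"
        using J_comb[OF pJ gJ real_polynomial_function_power[OF pc] u] .
      from e_min[OF this k] show ?thesis using u by (intro exI[of _ k] exI[of _ u]) simp
    qed
    obtain k u where u: "real_polynomial_function u" and k: "\<And>x. c x ^ k * h x = g x * u x"
      using div[OF hJ] by blast
    obtain l v where v: "real_polynomial_function v" and l: "\<And>x. c x ^ l * hi x = g x * v x"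
      using div[OF hiJ] by blast
    have cpow: "coord_poly i (\<lambda>x. c x ^ m) x = [:c x ^ m:]" for m x
      by (intro coord_poly_indep) (simp add: c_indep)
    have L1: "[:c x ^ k:] * coord_poly i h x = coord_poly i g x * coord_poly i u x" for x
      using coord_poly_mult[OF real_polynomial_function_power[OF pc] h(1), of k x]
        coord_poly_mult[OF pg u, of x] k by (simp add: cpow)
    have L2: "[:c x ^ l:] * pderiv (coord_poly i h x) = coord_poly i g x * coord_poly i v x" for x
    proof -
      have "pderiv (coord_poly i h x) = coord_poly i hi x"
        unfolding hi_def using coord_poly_derivative[OF h(1) h'(1)] by simp
      then show ?thesis using coord_poly_mult[OF real_polynomial_function_power[OF pc] phi, of l x]
        coord_poly_mult[OF pg v, of x] l by (simp add: cpow)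
    qed
    \<comment> \<open>The factor \<open>c x\<close> takes care of its own zeros. Elsewhere, unless
      \<open>?H\<close> is zero and hence \<open>?U\<close> too, \<open>?G\<close> divides
      \<open>?H\<close> and \<open>pderiv ?H\<close> up to nonzero constants. The order at the root
      \<open>x $ i\<close> drops by exactly one under \<open>pderiv\<close>, so \<open>?G\<close>
      cannot absorb the whole order of \<open>?H\<close> and \<open>?U\<close> vanishes as
      well.\<close>
    have vanish: "c x * u x = 0" if hx: "h x = 0" for x
    proof (cases "c x = 0")
      case cx: False
      let ?H = "coord_poly i h x" and ?G = "coord_poly i g x" and ?U = "coord_poly i u x"
      have G0: "?G \<noteq> 0" using cx unfolding c_def by auto
      have H0: "poly ?H (x $ i) = 0" using hx poly_coord_poly_self[OF h(1)] by simp
      have "poly ?U (x $ i) = 0"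
      proof (cases "?H = 0")
        case True
        then have "?U = 0" using L1[of x] G0 by simp
        then show ?thesis by simp
      next
        case Hn: False
        have ord: "order (x $ i) ?H = Suc (order (x $ i) (pderiv ?H))"
          using order_pderiv[OF Hn H0] .
        have pd: "pderiv ?H \<noteq> 0"
          using Hn H0 by (metis degree_eq_zeroE pderiv_eq_0_iff poly_pCons poly_0 mult_zero_right
              add.right_neutral pCons_0_0)
        have nz1: "[:c x ^ k:] * ?H \<noteq> 0" and nz2: "[:c x ^ l:] * pderiv ?H \<noteq> 0"
          using cx Hn pd by auto
        have o0: "order (x $ i) [:c x ^ m:] = 0" for m
          using cx by (intro order_0I) simp
        have "order (x $ i) ?H = order (x $ i) ?G + order (x $ i) ?U"
          using order_mult[OF nz1, of "x $ i"] order_mult[OF nz1[unfolded L1], of "x $ i"] o0[of k]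
          unfolding L1 by linarith
        moreover have "order (x $ i) ?G \<le> order (x $ i) (pderiv ?H)"
          using order_mult[OF nz2, of "x $ i"] order_mult[OF nz2[unfolded L2], of "x $ i"] o0[of l]
          unfolding L2 by linarith
        ultimately have "order (x $ i) ?U \<noteq> 0" using ord by simp
        then show ?thesis using order_root by blast
      qed
      then show ?thesis using poly_coord_poly_self[OF u] by simp
    qed simp
    have "real_polynomial_function (\<lambda>x. c x * u x)" using pc u by auto
    from gen[OF this vanish] obtain s where s: "real_polynomial_function s"
      and cus: "\<And>x. c x * u x = h x * s x" by blast
    \<comment> \<open>Degrees are compared at a generic point, where \<open>c\<close>, the leading
      coefficient of \<open>h\<close> and \<open>h\<close> itself are nonzero, so that the pointwise
      degrees are the generic ones.\<close>
    obtain D y where D: "coord_degree_less (Suc D) h" "coeff (coord_poly i h y) D \<noteq> 0"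
      using least_coord_degree[OF h] by blast
    have "\<exists>x. coeff (coord_poly i h x) D * h x \<noteq> 0"
      using real_polynomial_function_mult_nonzero[OF real_polynomial_function_coord_coeff[OF h(1)] D(2) h]
      by blast
    then obtain y' where y': "coeff (coord_poly i h y') D * h y' \<noteq> 0" by blast
    have "real_polynomial_function (\<lambda>x. coeff (coord_poly i h x) D * h x)"
      using real_polynomial_function_coord_coeff[OF h(1)] h by auto
    from real_polynomial_function_mult_nonzero[OF pc _ this y', of b] b
    obtain x where x: "c x \<noteq> 0" "coeff (coord_poly i h x) D \<noteq> 0" "h x \<noteq> 0"
      unfolding c_def by auto
    let ?H = "coord_poly i h x" and ?G = "coord_poly i g x" and ?U = "coord_poly i u x"
    have dH: "degree ?H = D" using D(1) x(2) unfolding coord_degree_less_def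
      by (metis Suc_leI leading_coeff_0_iff coeff_0 le_degree not_less order_le_less)
    have dG: "degree ?G = e" using e x(1) unfolding coord_degree_less_def c_def
      by (metis Suc_leI leading_coeff_0_iff coeff_0 le_degree not_less order_le_less)
    have "u x \<noteq> 0" using k[of x] x by auto
    then have U0: "?U \<noteq> 0" using poly_coord_poly_self[OF u, of x] by auto
    have G0: "?G \<noteq> 0" using x(1) unfolding c_def by auto
    have "degree ([:c x ^ k:] * ?H) = degree ?H" using x(1) by simp
    then have "D = e + degree ?U" using degree_mult_eq[OF G0 U0] dH dG unfolding L1 by linarith
    moreover have "coord_poly i (\<lambda>x. c x * u x) x = smult (c x) ?U"
      using coord_poly_mult[OF pc u, of x] coord_poly_indep[of c x] c_indep by simp
    moreover have "coord_poly i (\<lambda>x. c x * u x) x = ?H * coord_poly i s x"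
      unfolding cus using coord_poly_mult[OF h(1) s] .
    ultimately have "?H dvd smult (c x) ?U" by (metis dvd_triv_left)
    then have "D \<le> degree ?U" using U0 x(1) dH dvd_imp_degree_le[of ?H "smult (c x) ?U"] by simp
    with \<open>D = e + degree ?U\<close> False show ?thesis by simp
  qed
qed

end

section \<open>Constant sign of the generator\<close>

lemma connected_avoiding_frontier:
  assumes "connected S" "S \<inter> frontier G = {}" "x \<in> S" "y \<in> S"
  shows "x \<in> G \<longleftrightarrow> y \<in> G"
  using connected_Int_frontier[OF assms(1), of G] assms by blast

text \<open>A substitute for the implicit function theorem. Near \<open>x0\<close> the function
  \<open>h\<close> strictly increases along \<open>v\<close>, running from at most
  \<open>- \<eta>\<close> to at least \<open>\<eta>\<close>; its positive and its negative side are
  each connected by paths avoiding the frontier, so each lies wholly inside or wholly outside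
  \<open>G\<close>.\<close>

lemma transversal_flow_box:
  fixes h :: "'a::real_normed_vector \<Rightarrow> real"
  assumes fr: "frontier G = {x. h x = 0}"
    and h': "\<And>x. (h has_derivative h' x) (at x)" "continuous_on UNIV (\<lambda>x. h' x v)"
    and x0: "h x0 = 0" "0 < h' x0 v" and W: "open W" "x0 \<in> W"
  obtains \<tau> \<rho> \<eta> where "0 < \<tau>" "0 < \<rho>" "0 < \<eta>"
    "\<And>x s. x \<in> ball x0 \<rho> \<Longrightarrow> \<bar>s\<bar> \<le> \<tau> \<Longrightarrow> x + s *\<^sub>R v \<in> W \<and> 0 < h' (x + s *\<^sub>R v) v"
    "\<And>x. x \<in> ball x0 \<rho> \<Longrightarrow> \<eta> \<le> h (x + \<tau> *\<^sub>R v)"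
    "\<And>x. x \<in> ball x0 \<rho> \<Longrightarrow> h (x - \<tau> *\<^sub>R v) \<le> - \<eta>"
    "\<And>x s. x \<in> ball x0 \<rho> \<Longrightarrow> \<bar>s\<bar> \<le> \<tau> \<Longrightarrow> 0 < h (x + s *\<^sub>R v) \<Longrightarrow>
       x + s *\<^sub>R v \<in> G \<longleftrightarrow> x0 + \<tau> *\<^sub>R v \<in> G"
    "\<And>x s. x \<in> ball x0 \<rho> \<Longrightarrow> \<bar>s\<bar> \<le> \<tau> \<Longrightarrow> h (x + s *\<^sub>R v) < 0 \<Longrightarrow>
       x + s *\<^sub>R v \<in> G \<longleftrightarrow> x0 - \<tau> *\<^sub>R v \<in> G"
proof -
  have ch: "continuous_on UNIV h"
    using h'(1) has_derivative_continuous continuous_at_imp_continuous_on by blast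
  have "open ({x. 0 < h' x v} \<inter> W)"
    by (intro open_Int W open_Collect_less continuous_on_const h')
  then obtain r where r: "0 < r" "ball x0 r \<subseteq> {x. 0 < h' x v} \<inter> W"
    using x0(2) W openE[of "{x. 0 < h' x v} \<inter> W" x0] by auto
  \<comment> \<open>Then \<open>\<tau> * norm v\<close> is at most \<open>r / 2\<close>, and
    translates of the half-size ball stay in \<open>ball x0 r\<close>; the added 1 keeps the
    denominator positive.\<close>
  define \<tau> where "\<tau> = r / (2 * (norm v + 1))"
  have n1: "norm v + 1 > 0" by (simp add: add_nonneg_pos)
  then have \<tau>: "0 < \<tau>" using r(1) by (simp add: \<tau>_def)
  have \<tau>v: "\<tau> * norm v \<le> r / 2"
  proof -
    have "\<tau> * norm v \<le> \<tau> * (norm v + 1)" using \<tau> by simp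
    also have "\<dots> = r / 2" using n1 by (simp add: \<tau>_def divide_simps)
    finally show ?thesis .
  qed
  have in_ball: "x + s *\<^sub>R v \<in> ball x0 r" if "x \<in> ball x0 (r/2)" "\<bar>s\<bar> \<le> \<tau>" for x s
  proof -
    have "norm (x0 - (x + s *\<^sub>R v)) \<le> norm (x0 - x) + norm (s *\<^sub>R v)"
      by (metis diff_diff_eq norm_triangle_ineq4)
    also have "norm (s *\<^sub>R v) \<le> \<tau> * norm v" using that by (simp add: mult_right_mono)
    finally show ?thesis using that \<tau>v by (simp add: dist_norm)
  qed
  have pos: "x + s *\<^sub>R v \<in> W \<and> 0 < h' (x + s *\<^sub>R v) v" if "x \<in> ball x0 (r/2)" "\<bar>s\<bar> \<le> \<tau>" for x s
    using in_ball[OF that] r(2) by blast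
  have mono: "h (x + s *\<^sub>R v) < h (x + t *\<^sub>R v)"
    if "x \<in> ball x0 (r/2)" "-\<tau> \<le> s" "s < t" "t \<le> \<tau>" for x s t
  proof (rule DERIV_pos_imp_increasing[OF that(3)])
    fix u assume "s \<le> u" "u \<le> t"
    with that pos[OF that(1), of u]
    show "\<exists>y. ((\<lambda>s. h (x + s *\<^sub>R v)) has_real_derivative y) (at u) \<and> 0 < y"
      using has_real_derivative_along_line[OF h'(1), of x v u] by auto
  qed
  have x0b: "x0 \<in> ball x0 (r/2)" using r(1) by simp
  \<comment> \<open>Half of the smaller end value leaves strict inequalities at \<open>x0\<close>,
    which persist on a small ball.\<close>
  define \<eta> where "\<eta> = min (h (x0 + \<tau> *\<^sub>R v)) (- h (x0 - \<tau> *\<^sub>R v)) / 2"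
  have "0 < h (x0 + \<tau> *\<^sub>R v)" "h (x0 - \<tau> *\<^sub>R v) < 0"
    using mono[OF x0b, of 0 \<tau>] mono[OF x0b, of "-\<tau>" 0] \<tau> x0(1) by auto
  then have \<eta>: "0 < \<eta>" "\<eta> < h (x0 + \<tau> *\<^sub>R v)" "h (x0 - \<tau> *\<^sub>R v) < - \<eta>"
    unfolding \<eta>_def by (auto simp: min_def)
  have "open ({x. \<eta> < h (x + \<tau> *\<^sub>R v)} \<inter> {x. h (x - \<tau> *\<^sub>R v) < - \<eta>} \<inter> ball x0 (r/2))"
    by (intro open_Int open_ball open_Collect_less continuous_intros
        continuous_on_compose2[OF ch]) auto
  moreover have "x0 \<in> {x. \<eta> < h (x + \<tau> *\<^sub>R v)} \<inter> {x. h (x - \<tau> *\<^sub>R v) < - \<eta>} \<inter> ball x0 (r/2)"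
    using \<eta> x0b by simp
  ultimately obtain \<rho> where \<rho>: "0 < \<rho>"
    "ball x0 \<rho> \<subseteq> {x. \<eta> < h (x + \<tau> *\<^sub>R v)} \<inter> {x. h (x - \<tau> *\<^sub>R v) < - \<eta>} \<inter> ball x0 (r/2)"
    by (rule openE)
  have mono_le: "h (x + s *\<^sub>R v) \<le> h (x + t *\<^sub>R v)"
    if "x \<in> ball x0 (r/2)" "-\<tau> \<le> s" "s \<le> t" "t \<le> \<tau>" for x s t
    using mono[OF that(1,2) _ that(4)] that(3) by (cases "s = t") (auto simp: less_eq_real_def)
  have top: "x + s *\<^sub>R v \<in> G \<longleftrightarrow> x0 + \<tau> *\<^sub>R v \<in> G"
    if "x \<in> ball x0 \<rho>" "\<bar>s\<bar> \<le> \<tau>" "0 < h (x + s *\<^sub>R v)" for x s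
  proof -
    \<comment> \<open>The path first runs along \<open>v\<close> up to level \<open>\<tau>\<close>,
      where \<open>h\<close> only grows, and then across the translated ball, where \<open>h\<close>
      is at least \<open>\<eta>\<close>.\<close>
    have "x + s *\<^sub>R v \<in> G \<longleftrightarrow> x + \<tau> *\<^sub>R v \<in> G"
    proof (rule connected_avoiding_frontier)
      show "connected ((\<lambda>t. x + t *\<^sub>R v) ` {s..\<tau>})"
        by (intro connected_continuous_image continuous_intros) auto
      have "0 < h (x + t *\<^sub>R v)" if "t \<in> {s..\<tau>}" for t
        using mono_le[of x s t] that \<open>x \<in> ball x0 \<rho>\<close> \<rho>(2) \<open>\<bar>s\<bar> \<le> \<tau>\<close> \<open>0 < h (x + s *\<^sub>R v)\<close> by fastforce
      then show "(\<lambda>t. x + t *\<^sub>R v) ` {s..\<tau>} \<inter> frontier G = {}" unfolding fr by force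
    qed (use that in auto)
    also have "\<dots> \<longleftrightarrow> x0 + \<tau> *\<^sub>R v \<in> G"
    proof (rule connected_avoiding_frontier)
      show "connected ((\<lambda>x. x + \<tau> *\<^sub>R v) ` ball x0 \<rho>)"
        by (intro connected_continuous_image continuous_intros) auto
      show "(\<lambda>x. x + \<tau> *\<^sub>R v) ` ball x0 \<rho> \<inter> frontier G = {}" unfolding fr using \<rho>(2) \<eta>(1) by force
    qed (use that \<rho> in auto)
    finally show ?thesis .
  qed
  have bot: "x + s *\<^sub>R v \<in> G \<longleftrightarrow> x0 - \<tau> *\<^sub>R v \<in> G"
    if "x \<in> ball x0 \<rho>" "\<bar>s\<bar> \<le> \<tau>" "h (x + s *\<^sub>R v) < 0" for x s
  proof -
    have "x + s *\<^sub>R v \<in> G \<longleftrightarrow> x + (- \<tau>) *\<^sub>R v \<in> G"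
    proof (rule connected_avoiding_frontier)
      show "connected ((\<lambda>t. x + t *\<^sub>R v) ` {-\<tau>..s})"
        by (intro connected_continuous_image continuous_intros) auto
      have "h (x + t *\<^sub>R v) < 0" if "t \<in> {-\<tau>..s}" for t
        using mono_le[of x t s] that \<open>x \<in> ball x0 \<rho>\<close> \<rho>(2) \<open>\<bar>s\<bar> \<le> \<tau>\<close> \<open>h (x + s *\<^sub>R v) < 0\<close> by fastforce
      then show "(\<lambda>t. x + t *\<^sub>R v) ` {-\<tau>..s} \<inter> frontier G = {}" unfolding fr by force
      show "x + (- \<tau>) *\<^sub>R v \<in> (\<lambda>t. x + t *\<^sub>R v) ` {-\<tau>..s}"
        using that by (intro image_eqI[of _ _ "-\<tau>"]) auto
    qed (use that in auto)
    also have "\<dots> \<longleftrightarrow> x0 - \<tau> *\<^sub>R v \<in> G"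
    proof (rule connected_avoiding_frontier)
      show "connected ((\<lambda>x. x - \<tau> *\<^sub>R v) ` ball x0 \<rho>)"
        by (intro connected_continuous_image continuous_intros) auto
      show "(\<lambda>x. x - \<tau> *\<^sub>R v) ` ball x0 \<rho> \<inter> frontier G = {}" unfolding fr using \<rho>(2) \<eta>(1) by force
    qed (use that \<rho> in auto)
    finally show ?thesis .
  qed
  show ?thesis
    by (rule that[OF \<tau> \<rho>(1) \<eta>(1) _ _ _ top bot]) (use \<rho>(2) pos in \<open>auto simp: less_eq_real_def\<close>)
qed

text \<open>The two sides of the crossing cannot both lie in \<open>G\<close>, as \<open>x\<close>
  would then be interior to \<open>closure G\<close> and hence in \<open>G\<close>; nor can both lie
  outside, as \<open>x\<close> belongs to \<open>closure G\<close>. So exactly one sign of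
  \<open>h\<close> is the inside.\<close>

lemma constant_sign_local:
  fixes h :: "'a::real_normed_vector \<Rightarrow> real"
  assumes G: "open G" "G = interior (closure G)" and fr: "frontier G = {x. h x = 0}"
    and h': "\<And>x. (h has_derivative h' x) (at x)" "continuous_on UNIV (\<lambda>x. h' x v)"
    and x: "h x = 0" "0 < h' x v"
  shows "\<exists>r>0. (\<forall>y\<in>ball x r. h y \<noteq> 0 \<longrightarrow> (y \<in> G \<longleftrightarrow> 0 < h y)) \<or>
     (\<forall>y\<in>ball x r. h y \<noteq> 0 \<longrightarrow> (y \<in> G \<longleftrightarrow> h y < 0))"
proof -
  obtain \<tau> r where \<tau>: "0 < \<tau>" "0 < r"
    and top: "\<And>y s. y \<in> ball x r \<Longrightarrow> \<bar>s\<bar> \<le> \<tau> \<Longrightarrow> 0 < h (y + s *\<^sub>R v) \<Longrightarrow>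
       y + s *\<^sub>R v \<in> G \<longleftrightarrow> x + \<tau> *\<^sub>R v \<in> G"
    and bot: "\<And>y s. y \<in> ball x r \<Longrightarrow> \<bar>s\<bar> \<le> \<tau> \<Longrightarrow> h (y + s *\<^sub>R v) < 0 \<Longrightarrow>
       y + s *\<^sub>R v \<in> G \<longleftrightarrow> x - \<tau> *\<^sub>R v \<in> G"
    by (rule transversal_flow_box[OF fr h' x open_UNIV UNIV_I]) (rule that)
  have t: "y \<in> G \<longleftrightarrow> x + \<tau> *\<^sub>R v \<in> G" if "y \<in> ball x r" "0 < h y" for y
    using top[OF that(1), of 0] that \<tau> by simp
  have b: "y \<in> G \<longleftrightarrow> x - \<tau> *\<^sub>R v \<in> G" if "y \<in> ball x r" "h y < 0" for y
    using bot[OF that(1), of 0] that \<tau> by simp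
  have xf: "x \<in> frontier G" using x fr by simp
  then have xG: "x \<notin> G" "x \<in> closure G" using G(1) by (auto simp: frontier_def interior_open)
  have "\<not> (x + \<tau> *\<^sub>R v \<in> G \<and> x - \<tau> *\<^sub>R v \<in> G)"
  proof
    assume both: "x + \<tau> *\<^sub>R v \<in> G \<and> x - \<tau> *\<^sub>R v \<in> G"
    have "ball x r \<subseteq> closure G"
    proof
      fix y assume "y \<in> ball x r"
      then have "y \<in> G \<or> h y = 0" using t[of y] b[of y] both by force
      then show "y \<in> closure G" using fr closure_subset frontier_def by fast
    qed
    then have "x \<in> interior (closure G)"
      using \<tau>(2) by (meson centre_in_ball interior_maximal open_ball subsetD)
    with xG G(2) show False by simp
  qed
  moreover have "\<not> (x + \<tau> *\<^sub>R v \<notin> G \<and> x - \<tau> *\<^sub>R v \<notin> G)"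
  proof
    assume none: "x + \<tau> *\<^sub>R v \<notin> G \<and> x - \<tau> *\<^sub>R v \<notin> G"
    have "y \<notin> G" if "y \<in> ball x r" for y
    proof (cases "h y = 0")
      case True
      then have "y \<in> frontier G" using fr by simp
      then show ?thesis using G(1) by (simp add: frontier_def interior_open)
    next
      case False then show ?thesis using t[OF that] b[OF that] none by linarith
    qed
    then have "ball x r \<inter> G = {}" by auto
    then have "ball x r \<inter> closure G = {}" by (simp add: open_Int_closure_eq_empty)
    moreover have "x \<in> ball x r" using \<tau>(2) by simp
    ultimately show False using xG(2) by blast
  qed
  ultimately have "(\<forall>y\<in>ball x r. h y \<noteq> 0 \<longrightarrow> (y \<in> G \<longleftrightarrow> 0 < h y)) \<or>
     (\<forall>y\<in>ball x r. h y \<noteq> 0 \<longrightarrow> (y \<in> G \<longleftrightarrow> h y < 0))"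
    using t b by (smt (verit, best))
  then show ?thesis using \<tau>(2) by blast
qed

text \<open>Away from the common zeros of \<open>h\<close> and one of its partial derivatives, \<open>h\<close> changes sign exactly
  when \<open>G\<close> is entered or left. These zeros have codimension two, so this comparison of \<open>h\<close> with \<open>G\<close>
  has the same outcome everywhere.\<close>

lemma constant_sign:
  fixes h :: "real^'n::finite \<Rightarrow> real"
  assumes G: "open G" "G = interior (closure G)" and fr: "frontier G = {x. h x = 0}"
    and h: "real_polynomial_function h" "h a \<noteq> 0"
    and h': "\<And>x. (h has_derivative h' x) (at x)" "\<And>v. real_polynomial_function (\<lambda>x. h' x v)"
    and gen: "\<And>p. real_polynomial_function p \<Longrightarrow> (\<And>x. h x = 0 \<Longrightarrow> p x = 0) \<Longrightarrow>
       \<exists>q. real_polynomial_function q \<and> (\<forall>x. p x = h x * q x)"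
  shows "(\<forall>x\<in>G. 0 < h x) \<or> (\<forall>x\<in>G. h x < 0)"
proof (rule ccontr)
  assume neg: "\<not> ?thesis"
  have h0: "h x \<noteq> 0" if "x \<in> G" for x
    using that fr G(1) by (auto simp: frontier_def interior_open)
  obtain p m where p: "p \<in> G" "0 < h p" and m: "m \<in> G" "h m < 0"
    using neg h0 by (metis linorder_neqE_linordered_idom)
  \<comment> \<open>\<open>A\<close> collects the points near which positive values of
    \<open>h\<close> mark the inside of \<open>G\<close>, \<open>B\<close> those with negative
    values. Both are open, they are disjoint because \<open>h\<close> has no open set of zeros, and
    together they miss at most the zeros of \<open>h\<close> at which every partial derivative
    vanishes.\<close>
  define A where "A = {x. \<exists>r>0. \<forall>y\<in>ball x r. h y \<noteq> 0 \<longrightarrow> (y \<in> G \<longleftrightarrow> 0 < h y)}"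
  define B where "B = {x. \<exists>r>0. \<forall>y\<in>ball x r. h y \<noteq> 0 \<longrightarrow> (y \<in> G \<longleftrightarrow> h y < 0)}"
  have ch: "continuous_on UNIV h" by (rule real_polynomial_function_continuous_on[OF h(1)])
  have open_local: "open {x. \<exists>r>0. \<forall>y\<in>ball x r. P y}" for P :: "real^'n \<Rightarrow> bool"
  proof -
    have "{x. \<exists>r>0. \<forall>y\<in>ball x r. P y} = interior {y. P y}"
      by (simp add: set_eq_iff mem_interior subset_eq)
    then show ?thesis by simp
  qed
  have oA: "open A" and oB: "open B" unfolding A_def B_def by (rule open_local)+
  have disj: "A \<inter> B = {}"
  proof (rule ccontr)
    assume "A \<inter> B \<noteq> {}"
    then obtain x r s where "0 < r" "\<forall>y\<in>ball x r. h y \<noteq> 0 \<longrightarrow> (y \<in> G \<longleftrightarrow> 0 < h y)"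
      "0 < s" "\<forall>y\<in>ball x s. h y \<noteq> 0 \<longrightarrow> (y \<in> G \<longleftrightarrow> h y < 0)"
      unfolding A_def B_def by blast
    moreover from calculation have "ball x (min r s) \<noteq> {}" by simp
    then obtain y where "y \<in> ball x (min r s)" "h y \<noteq> 0"
      using real_polynomial_function_nonzero_dense[OF h open_ball] by blast
    ultimately show False by (metis linorder_neqE_linordered_idom mem_ball min_less_iff_conj not_less_iff_gr_or_eq)
  qed
  have cover0: "x \<in> A \<union> B" if "h x \<noteq> 0" for x
  proof -
    have "open {y. 0 < h y * h x}"
      by (intro open_Collect_less continuous_intros ch)
    moreover have "x \<in> {y. 0 < h y * h x}" using that by (simp add: zero_less_mult_iff) linarith
    ultimately obtain r where r: "0 < r" "ball x r \<subseteq> {y. 0 < h y * h x}" by (rule openE)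
    then have r2: "0 < h y * h x" if "y \<in> ball x r" for y using that by blast
    have "y \<in> G \<longleftrightarrow> x \<in> G" if "y \<in> ball x r" for y
    proof (rule connected_avoiding_frontier)
      show "ball x r \<inter> frontier G = {}" unfolding fr using r2 by force
    qed (use that r in auto)
    then have "(\<forall>y\<in>ball x r. h y \<noteq> 0 \<longrightarrow> (y \<in> G \<longleftrightarrow> 0 < h y)) \<or>
     (\<forall>y\<in>ball x r. h y \<noteq> 0 \<longrightarrow> (y \<in> G \<longleftrightarrow> h y < 0))"
      using r2 by (smt (verit, best) zero_less_mult_iff)
    then show ?thesis using r(1) unfolding A_def B_def by blast
  qed
  have cover: "x \<in> A \<union> B" if ne: "h x \<noteq> 0 \<or> h' x (axis i 1) \<noteq> 0" for x i
  proof (cases "h x = 0")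
    case True
    have "h' x (- axis i 1) = - h' x (axis i 1)"
      using h'(1)[of x] by (simp add: has_derivative_linear linear_neg)
    then obtain v where v: "0 < h' x v"
      using ne True by (metis linorder_neqE_linordered_idom neg_0_less_iff_less)
    show ?thesis
      using constant_sign_local[OF G fr h'(1) real_polynomial_function_continuous_on[OF h'(2)] True v]
      unfolding A_def B_def by blast
  qed (use cover0 in auto)
  have "\<exists>R b. real_polynomial_function R \<and> R b \<noteq> 0 \<and> (\<forall>x t. R (vec_upd x i t) = R x) \<and>
     (\<forall>x. h x = 0 \<and> h' x (axis i 1) = 0 \<longrightarrow> R x = 0)" for i
    by (rule radical_generator_discriminant[OF h h' gen])
  then obtain R b where R: "\<And>i. real_polynomial_function (R i)" "\<And>i. R i (b i) \<noteq> 0"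
     "\<And>i x t. R i (vec_upd x i t) = R i x"
     "\<And>i x. h x = 0 \<Longrightarrow> h' x (axis i 1) = 0 \<Longrightarrow> R i x = 0"
    by metis
  \<comment> \<open>If \<open>R i x\<close> is nonzero, the whole line through \<open>x\<close>
    along axis \<open>i\<close> avoids the bad points, because \<open>R i\<close> is constant on it;
    being connected, the line lies in one of \<open>A\<close> and \<open>B\<close>.\<close>
  have line: "vec_upd x i t \<in> A" if x: "x \<in> A" "R i x \<noteq> 0" for x i t
  proof -
    let ?f = "\<lambda>t. vec_upd x i t"
    have cont: "continuous_on UNIV ?f"
      unfolding vec_upd_eq_add[of x i] by (intro continuous_intros)
    have op: "open (?f -` A)" "open (?f -` B)"
      using cont oA oB by (auto intro!: open_vimage)
    have all: "?f -` A \<union> ?f -` B = UNIV"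
    proof -
      have "?f t \<in> A \<union> B" for t
        using cover[of "?f t" i] R(3)[of i] R(4)[of _ i] x(2) by metis
      then show ?thesis by blast
    qed
    have "x $ i \<in> ?f -` A" using x by simp
    then have "?f -` B = {}"
      using connectedD[OF connected_UNIV op] all disj by blast
    then show ?thesis using all by blast
  qed
  have "\<exists>r>0. \<forall>x. (\<forall>j. \<bar>x $ j - p $ j\<bar> < r) \<longrightarrow> x \<in> A"
  proof -
    have "p \<in> A"
    proof -
      have "open (G \<inter> {y. 0 < h y})" using G(1) by (intro open_Int open_Collect_less continuous_intros ch)
      then obtain r where "0 < r" "ball p r \<subseteq> G \<inter> {y. 0 < h y}" using p openE by blast
      then show ?thesis unfolding A_def by blast
    qed
    then obtain r where r: "0 < r" "ball p r \<subseteq> A" using oA openE by blast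
    have "x \<in> A" if x: "\<forall>j. \<bar>x $ j - p $ j\<bar> < r / real CARD('n)" for x
    proof -
      have "norm (x - p) \<le> (\<Sum>j\<in>UNIV. \<bar>(x - p) $ j\<bar>)" by (rule norm_le_l1_cart)
      also have "\<dots> < (\<Sum>j\<in>(UNIV::'n set). r / real CARD('n))"
        using x by (intro sum_strict_mono) auto
      also have "\<dots> = r" by simp
      finally have "x \<in> ball p r" by (simp add: dist_norm norm_minus_commute)
      then show ?thesis using r by blast
    qed
    then show ?thesis using r(1) by (intro exI[of _ "r / real CARD('n)"]) auto
  qed
  then obtain r where r: "0 < r" "\<And>x. (\<forall>j. \<bar>x $ j - p $ j\<bar> < r) \<Longrightarrow> x \<in> A" by blast
  \<comment> \<open>\<open>T\<close> holds the coordinates not yet known to be close to those of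
    \<open>p\<close>. Sweeping \<open>U\<close> along axis \<open>i\<close> and keeping the part
    close to \<open>p\<close> there gives an open set that meets \<open>A\<close> by induction, even
    at a point with \<open>R i\<close> nonzero, and \<open>line\<close> transports that point back
    into \<open>U\<close>. With all coordinates in \<open>T\<close> this makes \<open>A\<close>
    dense.\<close>
  have dense: "U \<inter> A \<noteq> {}"
    if "finite T" "open U" "U \<noteq> {}" "U \<subseteq> {x. \<forall>j. j \<notin> T \<longrightarrow> \<bar>x $ j - p $ j\<bar> < r}" for T U
    using that
  proof (induction T arbitrary: U rule: finite_induct)
    case empty
    then obtain u where "u \<in> U" "\<forall>j. \<bar>u $ j - p $ j\<bar> < r" by blast
    then show ?case using r(2)[of u] by blast
  next
    case (insert i T)
    define U' where "U' = {x. \<bar>x $ i - p $ i\<bar> < r} \<inter> (\<Union>t. (\<lambda>x. vec_upd x i t) -` U)"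
    have "open ((\<lambda>x. vec_upd x i t) -` U)" for t
      unfolding vec_upd_eq_add using insert.prems(1)
      by (intro open_vimage continuous_intros)
    then have "open (\<Union>t. (\<lambda>x. vec_upd x i t) -` U)" by (intro open_UN ballI)
    moreover have "open {x. \<bar>x $ i - p $ i\<bar> < r}"
      by (intro open_Collect_less continuous_intros)
    ultimately have oU: "open U'" unfolding U'_def by (rule open_Int[rotated])
    obtain u where "u \<in> U" using insert.prems(2) by blast
    then have "vec_upd u i (p $ i) \<in> U'" unfolding U'_def using r(1)
      by (auto intro!: exI[of _ "u $ i"])
    then have "U' \<noteq> {}" by blast
    moreover have "U' \<subseteq> {x. \<forall>j. j \<notin> T \<longrightarrow> \<bar>x $ j - p $ j\<bar> < r}"
    proof
      fix x assume "x \<in> U'"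
      then obtain t where "\<bar>x $ i - p $ i\<bar> < r" "vec_upd x i t \<in> U" unfolding U'_def by blast
      then have "\<bar>x $ j - p $ j\<bar> < r" if "j \<notin> T" for j
        using insert.prems(3) that by (cases "j = i") (auto dest!: subsetD split: if_splits)
      then show "x \<in> {x. \<forall>j. j \<notin> T \<longrightarrow> \<bar>x $ j - p $ j\<bar> < r}" by blast
    qed
    ultimately have "U' \<inter> A \<noteq> {}" using insert.IH oU by blast
    then obtain x where "x \<in> U' \<inter> A" "R i x \<noteq> 0"
      using real_polynomial_function_nonzero_dense[OF R(1,2), of "U' \<inter> A" i] oU oA by blast
    then obtain t where "vec_upd x i t \<in> U" "vec_upd x i t \<in> A"
      using line unfolding U'_def by blast
    then show ?case by blast
  qed
  have "m \<in> B"
  proof -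
    have "open (G \<inter> {y. h y < 0})" using G(1) by (intro open_Int open_Collect_less continuous_intros ch)
    then obtain r where "0 < r" "ball m r \<subseteq> G \<inter> {y. h y < 0}" using m openE by blast
    then show ?thesis unfolding B_def by blast
  qed
  then have "B \<inter> A \<noteq> {}" using dense[OF finite[of UNIV] oB] by auto
  with disj show False by blast
qed

section \<open>The divergence theorem without surface integrals\<close>

lemma set_integrable_continuous_on_bounded_open:
  fixes f :: "'a::euclidean_space \<Rightarrow> real"
  assumes "open G" "bounded G" "continuous_on UNIV f"
  shows "set_integrable lborel G f"
proof -
  obtain r where "G \<subseteq> cball 0 r"
    using assms(2) by (meson ball_subset_cball bounded_subset_ballD order_trans)
  moreover have "set_integrable lborel (cball 0 r) f"
    unfolding set_integrable_def
    by (intro borel_integrable_compact continuous_on_subset[OF assms(3)]) auto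
  ultimately show ?thesis using assms(1) by (auto intro: set_integrable_subset)
qed

lemma lborel_integral_translation:
  fixes f :: "'a::euclidean_space \<Rightarrow> real"
  assumes "f \<in> borel_measurable borel"
  shows "integral\<^sup>L lborel (\<lambda>x. f (x + c)) = integral\<^sup>L lborel f"
proof -
  have "integral\<^sup>L lborel f = integral\<^sup>L (distr lborel borel ((+) c)) f"
    by (simp add: lborel_distr_plus)
  also have "\<dots> = integral\<^sup>L lborel (\<lambda>x. f (c + x))"
    using assms by (intro integral_distr) auto
  finally show ?thesis by (simp add: add.commute)
qed

lemma lborel_integrable_translation:
  fixes f :: "'a::euclidean_space \<Rightarrow> real"
  assumes "integrable lborel f"
  shows "integrable lborel (\<lambda>x. f (x + c))"
proof -
  have "integrable (distr lborel borel ((+) c)) f"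
    using assms by (simp add: lborel_distr_plus)
  then have "integrable lborel (\<lambda>x. f (c + x))"
    using assms by (subst (asm) integrable_distr_eq) auto
  then show ?thesis by (simp add: add.commute)
qed

text \<open>Cutting off at the frontier does not spoil the Lipschitz bound: a segment with one end
  in \<open>G\<close> and the other outside meets the frontier, where \<open>w\<close> is zero, and
  the mean value bound applies from there to the inner end.\<close>

lemma difference_quotient_bound:
  fixes w :: "'a::real_normed_vector \<Rightarrow> real"
  assumes w: "\<And>x. (w has_derivative w' x) (at x)"
    and fr: "\<And>x. x \<in> frontier G \<Longrightarrow> w x = 0"
    and r: "G \<subseteq> cball 0 r" and M: "\<And>x. x \<in> cball 0 (r + norm v) \<Longrightarrow> \<bar>w' x v\<bar> \<le> M" "0 \<le> M"
    and s: "0 < s" "s \<le> 1"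
  shows "\<bar>indicator G (x + s *\<^sub>R v) * w (x + s *\<^sub>R v) - indicator G x * w x\<bar>
     \<le> s * M * indicator (cball 0 (r + norm v)) x"
proof (cases "x \<in> G \<or> x + s *\<^sub>R v \<in> G")
  case True
  have sv: "norm (t *\<^sub>R v) \<le> norm v" if "\<bar>t\<bar> \<le> 1" for t :: real
    using that by (simp add: mult_left_le_one_le)
  have xin: "x \<in> cball 0 (r + norm v)" "x + s *\<^sub>R v \<in> cball 0 (r + norm v)"
  proof -
    have "norm x \<le> r + norm v \<and> norm (x + s *\<^sub>R v) \<le> r + norm v"
    proof (cases "x \<in> G")
      case True
      then have "norm x \<le> r" using r by auto
      then show ?thesis using norm_triangle_ineq[of x "s *\<^sub>R v"] sv[of s] s norm_ge_zero[of v] by linarith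
    next
      case False
      then have "norm (x + s *\<^sub>R v) \<le> r" using True r by auto
      moreover have "norm x \<le> norm (x + s *\<^sub>R v) + norm (s *\<^sub>R v)"
        using norm_triangle_ineq4[of "x + s *\<^sub>R v" "s *\<^sub>R v"] by simp
      ultimately show ?thesis using sv[of s] s norm_ge_zero[of v] by linarith
    qed
    then show "x \<in> cball 0 (r + norm v)" "x + s *\<^sub>R v \<in> cball 0 (r + norm v)" by simp_all
  qed
  have seg: "x + t *\<^sub>R v \<in> cball 0 (r + norm v)" if "0 \<le> t" "t \<le> s" for t
  proof -
    have "x + t *\<^sub>R v = (1 - t / s) *\<^sub>R x + (t / s) *\<^sub>R (x + s *\<^sub>R v)"
      using s by (simp add: algebra_simps)
    moreover have "(1 - t / s) *\<^sub>R x + (t / s) *\<^sub>R (x + s *\<^sub>R v) \<in> cball 0 (r + norm v)"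
      using that s by (intro convexD[OF convex_cball] xin) auto
    ultimately show ?thesis by simp
  qed
  have lip: "\<bar>w (x + b *\<^sub>R v) - w (x + a *\<^sub>R v)\<bar> \<le> s * M" if "0 \<le> a" "a \<le> b" "b \<le> s" for a b
  proof -
    have "norm (w (x + b *\<^sub>R v) - w (x + a *\<^sub>R v)) \<le> M * norm (b - a)"
    proof (rule field_differentiable_bound[of "{a..b}" "\<lambda>t. w (x + t *\<^sub>R v)" "\<lambda>t. w' (x + t *\<^sub>R v) v"])
      fix t assume "t \<in> {a..b}"
      then show "((\<lambda>t. w (x + t *\<^sub>R v)) has_field_derivative w' (x + t *\<^sub>R v) v) (at t within {a..b})"
        "norm (w' (x + t *\<^sub>R v) v) \<le> M"
        using has_real_derivative_along_line[OF w, of x v t] M(1)[OF seg, of t] that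
        by (auto intro: has_field_derivative_at_within)
    qed (use that in auto)
    also have "\<dots> \<le> M * s" using that M(2) by (intro mult_left_mono) auto
    finally show ?thesis by (simp add: mult.commute)
  qed
  have "\<bar>indicator G (x + s *\<^sub>R v) * w (x + s *\<^sub>R v) - indicator G x * w x\<bar> \<le> s * M"
  proof (cases "x \<in> G \<and> x + s *\<^sub>R v \<in> G")
    case True
    then show ?thesis using lip[of 0 s] s by simp
  next
    case False
    have "connected ((\<lambda>t. x + t *\<^sub>R v) ` {0..s})"
      by (intro connected_continuous_image continuous_intros) auto
    moreover have ends: "x \<in> (\<lambda>t. x + t *\<^sub>R v) ` {0..s}" "x + s *\<^sub>R v \<in> (\<lambda>t. x + t *\<^sub>R v) ` {0..s}"
      using s by (auto intro: image_eqI[of _ _ 0])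
    ultimately have "(\<lambda>t. x + t *\<^sub>R v) ` {0..s} \<inter> frontier G \<noteq> {}"
      using False True by (intro connected_Int_frontier) blast+
    then obtain t where t: "0 \<le> t" "t \<le> s" "w (x + t *\<^sub>R v) = 0"
      using fr by (auto simp: set_eq_iff)
    show ?thesis
      using False True lip[of 0 t] lip[of t s] t s M(2) by (auto simp: indicator_def)
  qed
  then show ?thesis using xin by simp
qed (use s M(2) in \<open>simp add: indicator_def\<close>)

text \<open>The function \<open>indicator G x * w x\<close> and its translates have equal integrals,
  so its difference quotients integrate to zero. They are dominated and converge to
  \<open>indicator G x * w' x v\<close>, since both \<open>w\<close> and its derivative along
  \<open>v\<close> vanish on the frontier.\<close>

lemma integral_directional_derivative_eq_0:
  fixes w :: "'a::euclidean_space \<Rightarrow> real"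
  assumes G: "open G" "bounded G"
    and w: "\<And>x. (w has_derivative w' x) (at x)" "continuous_on UNIV (\<lambda>x. w' x v)"
    and fr: "\<And>x. x \<in> frontier G \<Longrightarrow> w x = 0" "\<And>x. x \<in> frontier G \<Longrightarrow> w' x v = 0"
  shows "(LINT x:G|lborel. w' x v) = 0"
proof -
  define F where "F = (\<lambda>x. indicator G x * w x)"
  define \<delta> where "\<delta> = (\<lambda>k::nat. 1 / (real k + 1))"
  define D where "D = (\<lambda>k x. (F (x + \<delta> k *\<^sub>R v) - F x) / \<delta> k)"
  have \<delta>: "0 < \<delta> k" "\<delta> k \<le> 1" for k by (auto simp: \<delta>_def)
  have \<delta>0: "\<delta> \<longlonglongrightarrow> 0"
    unfolding \<delta>_def using LIMSEQ_inverse_real_of_nat by (simp add: inverse_eq_divide add.commute)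
  have cw: "continuous_on UNIV w"
    using w(1) has_derivative_continuous continuous_at_imp_continuous_on by blast
  have Fi: "integrable lborel F"
    using set_integrable_continuous_on_bounded_open[OF G cw] by (simp add: F_def set_integrable_def)
  obtain r where r: "G \<subseteq> cball 0 r"
    using G(2) by (meson ball_subset_cball bounded_subset_ballD order_trans)
  have "compact ((\<lambda>x. w' x v) ` cball 0 (r + norm v))"
    by (intro compact_continuous_image continuous_on_subset[OF w(2)]) auto
  then have "bounded ((\<lambda>x. w' x v) ` cball 0 (r + norm v))" by (rule compact_imp_bounded)
  then obtain M0 where M0: "\<And>x. x \<in> cball 0 (r + norm v) \<Longrightarrow> \<bar>w' x v\<bar> \<le> M0"
    unfolding bounded_iff by (metis imageI real_norm_def)
  define M where "M = \<bar>M0\<bar>"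
  have M: "\<And>x. x \<in> cball 0 (r + norm v) \<Longrightarrow> \<bar>w' x v\<bar> \<le> M" "0 \<le> M"
    using M0 by (fastforce simp: M_def)+
  have Dint: "integral\<^sup>L lborel (D k) = 0" for k
    unfolding D_def
    using lborel_integrable_translation[OF Fi] Fi lborel_integral_translation[of F]
    by (simp add: borel_measurable_integrable)
  have "(\<lambda>k. integral\<^sup>L lborel (D k)) \<longlonglongrightarrow> integral\<^sup>L lborel (\<lambda>x. indicator G x * w' x v)"
  proof (rule integral_dominated_convergence[where w = "\<lambda>x. M * indicator (cball 0 (r + norm v)) x"])
    show "(\<lambda>x. indicator G x * w' x v) \<in> borel_measurable lborel"
      using set_integrable_continuous_on_bounded_open[OF G w(2)]
      by (simp add: set_integrable_def borel_measurable_integrable)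
    show "D k \<in> borel_measurable lborel" for k
      unfolding D_def using lborel_integrable_translation[OF Fi, of "\<delta> k *\<^sub>R v"] Fi
      by (auto dest!: borel_measurable_integrable)
    show "integrable lborel (\<lambda>x. M * indicator (cball 0 (r + norm v)) x :: real)"
      using borel_integrable_compact[of "cball 0 (r + norm v)" "\<lambda>x. M"] by (simp add: mult.commute)
    have "norm (D k x) \<le> M * indicator (cball 0 (r + norm v)) x" for k x
      using difference_quotient_bound[OF w(1) fr(1) r M \<delta>, of x] \<delta>(1)[of k]
      unfolding D_def F_def by (simp add: divide_simps mult_ac)
    then show "AE x in lborel. norm (D k x) \<le> M * indicator (cball 0 (r + norm v)) x" for k by simp
    have "(\<lambda>k. D k x) \<longlonglongrightarrow> indicator G x * w' x v" for x
    proof -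
      have quot: "(\<lambda>k. (w (x + \<delta> k *\<^sub>R v) - w x) / \<delta> k) \<longlonglongrightarrow> w' x v"
      proof -
        have "((\<lambda>s. (w (x + s *\<^sub>R v) - w x) / s) \<longlongrightarrow> w' x v) (at 0)"
          using has_real_derivative_along_line[OF w(1), of x v 0] by (simp add: DERIV_def)
        moreover have "filterlim \<delta> (at 0) sequentially"
          using \<delta>0 \<delta>(1) by (auto simp: filterlim_at eventually_sequentially less_imp_neq[symmetric])
        ultimately show ?thesis by (rule filterlim_compose)
      qed
      have xl: "(\<lambda>k. x + \<delta> k *\<^sub>R v) \<longlonglongrightarrow> x"
        using tendsto_add[OF tendsto_const[of x] tendsto_scaleR[OF \<delta>0 tendsto_const[of v]]] by simp
      \<comment> \<open>At a frontier point the quotient is dominated by that of \<open>w\<close>,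
        whose limit \<open>w' x v\<close> is zero there; so the convergence holds at every point,
        whatever the measure of the frontier.\<close>
      consider "x \<in> G" | "x \<in> frontier G" | "x \<in> - closure G"
        using G(1) by (auto simp: frontier_def interior_open)
      then show ?thesis
      proof cases
        case 1
        then have "eventually (\<lambda>k. x + \<delta> k *\<^sub>R v \<in> G) sequentially"
          using xl G(1) topological_tendstoD by blast
        then have "eventually (\<lambda>k. D k x = (w (x + \<delta> k *\<^sub>R v) - w x) / \<delta> k) sequentially"
          by eventually_elim (use 1 in \<open>simp add: D_def F_def\<close>)
        then show ?thesis using quot 1 by (simp add: tendsto_cong)
      next
        case 2
        then have xG: "x \<notin> G" using G(1) by (simp add: frontier_def interior_open)
        have "norm (D k x) \<le> norm ((w (x + \<delta> k *\<^sub>R v) - w x) / \<delta> k)" for k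
          using xG fr(1)[OF 2] \<delta>(1)[of k] by (auto simp: D_def F_def indicator_def abs_mult)
        moreover have lim: "(\<lambda>k. (w (x + \<delta> k *\<^sub>R v) - w x) / \<delta> k) \<longlonglongrightarrow> 0"
          using quot fr(2)[OF 2] by simp
        ultimately have "(\<lambda>k. D k x) \<longlonglongrightarrow> 0"
          by (intro Lim_null_comparison[OF _ tendsto_norm_zero[OF lim]] always_eventually allI)
        then show ?thesis using xG by simp
      next
        case 3
        then have "eventually (\<lambda>k. x + \<delta> k *\<^sub>R v \<in> - closure G) sequentially"
          using topological_tendstoD[OF xl, of "- closure G"] by (simp add: open_Compl)
        then have "eventually (\<lambda>k. D k x = 0) sequentially"
        proof eventually_elim
          case (elim k)
          then show ?case using 3 closure_subset[of G] by (auto simp: D_def F_def indicator_def)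
        qed
        moreover have "x \<notin> G" using 3 closure_subset by blast
        ultimately show ?thesis by (simp add: tendsto_eventually)
      qed
    qed
    then show "AE x in lborel. (\<lambda>k. D k x) \<longlonglongrightarrow> indicator G x * w' x v" by simp
  qed
  then have "integral\<^sup>L lborel (\<lambda>x. indicator G x * w' x v) = 0"
    unfolding Dint using LIMSEQ_unique tendsto_const by blast
  then show ?thesis by (simp add: set_lebesgue_integral_def)
qed

section \<open>A rational cutoff and its layer weight\<close>

definition cutoff :: "real \<Rightarrow> real \<Rightarrow> real" where
  "cutoff \<epsilon> s = s\<^sup>2 / (s\<^sup>2 + \<epsilon>\<^sup>2)"

text \<open>The derivative of \<open>cutoff \<epsilon>\<close>. On s \<ge> 0 it is a smoothed delta
  function at 0: for positive \<open>\<epsilon>\<close> its total mass is 1, and it concentrates at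
  0 as \<open>\<epsilon>\<close> shrinks. With s = \<open>h x\<close> it plays the part of the
  surface measure.\<close>

definition cutoff' :: "real \<Rightarrow> real \<Rightarrow> real" where
  "cutoff' \<epsilon> s = 2 * s * \<epsilon>\<^sup>2 / (s\<^sup>2 + \<epsilon>\<^sup>2)\<^sup>2"

lemma cutoff_denominator_pos: "0 < \<epsilon> \<Longrightarrow> 0 < s\<^sup>2 + \<epsilon>\<^sup>2" for s \<epsilon> :: real
  by (simp add: add_nonneg_pos)

lemma cutoff_derivative:
  assumes "0 < \<epsilon>" shows "(cutoff \<epsilon> has_real_derivative cutoff' \<epsilon> s) (at s)"
  unfolding cutoff_def cutoff'_def using cutoff_denominator_pos[OF assms, of s]
  by (auto intro!: derivative_eq_intros simp: power2_eq_square divide_simps) (simp_all add: algebra_simps)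

lemma continuous_on_cutoff:
  assumes "0 < \<epsilon>" "continuous_on S f"
  shows "continuous_on S (\<lambda>x. cutoff \<epsilon> (f x))" "continuous_on S (\<lambda>x. cutoff' \<epsilon> (f x))"
  unfolding cutoff_def cutoff'_def
  using cutoff_denominator_pos[OF assms(1)]
  by (auto intro!: continuous_intros assms simp: less_imp_neq[symmetric])

lemma cutoff_0 [simp]: "cutoff \<epsilon> 0 = 0" "cutoff' \<epsilon> 0 = 0"
  by (simp_all add: cutoff_def cutoff'_def)

lemma cutoff_bounds: "0 \<le> cutoff \<epsilon> s" "cutoff \<epsilon> s \<le> 1"
proof -
  have "s\<^sup>2 / (s\<^sup>2 + \<epsilon>\<^sup>2) \<le> (s\<^sup>2 + \<epsilon>\<^sup>2) / (s\<^sup>2 + \<epsilon>\<^sup>2)"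
    by (intro divide_right_mono) auto
  also have "\<dots> \<le> 1" by simp
  finally show "cutoff \<epsilon> s \<le> 1" by (simp add: cutoff_def)
qed (simp add: cutoff_def)

lemma cutoff'_nonneg: "0 \<le> s \<Longrightarrow> 0 \<le> cutoff' \<epsilon> s"
  by (simp add: cutoff'_def)

lemma cutoff_ge_half: "0 < \<epsilon> \<Longrightarrow> \<epsilon> \<le> s \<Longrightarrow> 1/2 \<le> cutoff \<epsilon> s"
  using power_mono[of \<epsilon> s 2] cutoff_denominator_pos[of \<epsilon> s]
  by (simp add: cutoff_def divide_simps)

text \<open>An instance of the inequality 2 a b \<le> (a + b)^2 for nonnegative a and b. The bound
  is uniform in \<open>\<epsilon>\<close>, although \<open>cutoff'\<close> alone is unbounded as
  \<open>\<epsilon>\<close> tends to zero.\<close>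

lemma cutoff'_mult_bound: "\<bar>s * cutoff' \<epsilon> s\<bar> \<le> 1"
proof -
  have "2 * (s\<^sup>2 * \<epsilon>\<^sup>2) \<le> (s\<^sup>2 + \<epsilon>\<^sup>2)\<^sup>2"
    by (simp add: power2_sum)
  moreover have "s * cutoff' \<epsilon> s = 2 * (s\<^sup>2 * \<epsilon>\<^sup>2) / (s\<^sup>2 + \<epsilon>\<^sup>2)\<^sup>2"
    by (simp add: cutoff'_def power2_eq_square mult_ac)
  ultimately show ?thesis by (simp add: divide_le_eq_1)
qed

definition inv_Suc :: "nat \<Rightarrow> real" where "inv_Suc k = 1 / (real k + 1)"

lemma inv_Suc_pos [simp]: "0 < inv_Suc k" by (simp add: inv_Suc_def)

lemma inv_Suc_tendsto_0: "inv_Suc \<longlonglongrightarrow> 0"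
  unfolding inv_Suc_def using LIMSEQ_inverse_real_of_nat by (simp add: inverse_eq_divide add.commute)

lemma cutoff_tendsto: "s \<noteq> 0 \<Longrightarrow> (\<lambda>k. cutoff (inv_Suc k) s) \<longlonglongrightarrow> 1"
  unfolding cutoff_def by (rule tendsto_eq_intros inv_Suc_tendsto_0 refl | simp)+

lemma cutoff'_tendsto: "s \<noteq> 0 \<Longrightarrow> (\<lambda>k. cutoff' (inv_Suc k) s) \<longlonglongrightarrow> 0"
  unfolding cutoff'_def by (rule tendsto_eq_intros inv_Suc_tendsto_0 refl | simp)+

lemma set_integral_dominated_convergence:
  fixes f :: "'a::euclidean_space \<Rightarrow> real" and s :: "nat \<Rightarrow> 'a \<Rightarrow> real"
  assumes G: "open G" "bounded G"
    and cont: "\<And>k. continuous_on UNIV (s k)" "continuous_on UNIV f" "continuous_on UNIV b"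
    and lim: "\<And>x. x \<in> G \<Longrightarrow> (\<lambda>k. s k x) \<longlonglongrightarrow> f x"
    and bound: "\<And>k x. x \<in> G \<Longrightarrow> \<bar>s k x\<bar> \<le> b x"
  shows "(\<lambda>k. LINT x:G|lborel. s k x) \<longlonglongrightarrow> (LINT x:G|lborel. f x)"
  unfolding set_lebesgue_integral_def
proof (rule integral_dominated_convergence[where w = "\<lambda>x. indicator G x *\<^sub>R b x"])
  show "(\<lambda>x. indicat_real G x *\<^sub>R f x) \<in> borel_measurable lborel"
    "(\<lambda>x. indicat_real G x *\<^sub>R s k x) \<in> borel_measurable lborel"
    "integrable lborel (\<lambda>x. indicat_real G x *\<^sub>R b x)" for k
    using set_integrable_continuous_on_bounded_open[OF G cont(2)]
      set_integrable_continuous_on_bounded_open[OF G cont(1)[of k]]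
      set_integrable_continuous_on_bounded_open[OF G cont(3)]
    unfolding set_integrable_def by (auto dest: borel_measurable_integrable)
  show "AE x in lborel. (\<lambda>k. indicat_real G x *\<^sub>R s k x) \<longlonglongrightarrow> indicat_real G x *\<^sub>R f x"
    using lim by (auto simp: indicator_def)
  show "AE x in lborel. norm (indicat_real G x *\<^sub>R s k x) \<le> indicat_real G x *\<^sub>R b x" for k
    using bound by (auto simp: indicator_def)
qed

lemma real_polynomial_function_radial_derivative:
  fixes p :: "real^'n::finite \<Rightarrow> real"
  assumes "\<And>x. (p has_derivative p' x) (at x)" "\<And>v. real_polynomial_function (\<lambda>x. p' x v)"
  shows "real_polynomial_function (\<lambda>x. p' x x)"
proof -
  have "(\<lambda>x. p' x x) = (\<lambda>x. \<Sum>i\<in>UNIV. x $ i * p' x (axis i 1))"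
    using assms(1) has_derivative_linear linear_axis_expansion by blast
  moreover have "real_polynomial_function (\<lambda>x. \<Sum>i\<in>UNIV. x $ i * p' x (axis i 1))"
    by (intro real_polynomial_function_sum real_polynomial_function.intros(4)
        real_polynomial_function_nth assms) simp
  ultimately show ?thesis by simp
qed

section \<open>Flux of radial fields through a polynomial frontier\<close>

locale polynomial_frontier =
  fixes G :: "(real^'n::finite) set" and h :: "real^'n \<Rightarrow> real" and h' :: "real^'n \<Rightarrow> real^'n \<Rightarrow> real"
  assumes open_G: "open G" and bounded_G: "bounded G"
    and frontier_G: "frontier G = {x. h x = 0}"
    and poly_h: "real_polynomial_function h"
    and deriv_h: "\<And>x. (h has_derivative h' x) (at x)"
    and poly_h': "\<And>v. real_polynomial_function (\<lambda>x. h' x v)"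
begin

lemma h_nonzero: "x \<in> G \<Longrightarrow> h x \<noteq> 0"
  using frontier_G open_G by (auto simp: frontier_def interior_open)

text \<open>The components of the field \<open>\<psi> x * cutoff \<epsilon> (h x)\<close> times x
  vanish on the frontier together with their derivatives, and the axis identities add up to its
  divergence. The term \<open>real CARD('n) * \<psi> x + \<psi>' x x\<close> is the divergence of
  \<open>\<psi> x\<close> times x.\<close>

lemma divergence_cutoff:
  fixes \<psi> :: "real^'n \<Rightarrow> real"
  assumes \<epsilon>: "0 < \<epsilon>" and \<psi>: "real_polynomial_function \<psi>"
    and \<psi>': "\<And>x. (\<psi> has_derivative \<psi>' x) (at x)" "\<And>v. real_polynomial_function (\<lambda>x. \<psi>' x v)"
  shows "(LINT x:G|lborel. cutoff \<epsilon> (h x) * (real CARD('n) * \<psi> x + \<psi>' x x)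
     + \<psi> x * cutoff' \<epsilon> (h x) * h' x x) = 0"
proof -
  define w where "w = (\<lambda>i (x::real^'n). x $ i * (\<psi> x * cutoff \<epsilon> (h x)))"
  define w' where "w' = (\<lambda>i (x::real^'n) (v::real^'n). x $ i *
     (\<psi> x * (cutoff' \<epsilon> (h x) * h' x v) + \<psi>' x v * cutoff \<epsilon> (h x)) + v $ i * (\<psi> x * cutoff \<epsilon> (h x)))"
  note ch = real_polynomial_function_continuous_on[OF poly_h]
  note cont = continuous_on_cutoff[OF \<epsilon> ch] real_polynomial_function_continuous_on[OF \<psi>]
    real_polynomial_function_continuous_on[OF \<psi>'(2)] real_polynomial_function_continuous_on[OF poly_h']
  have cut: "((\<lambda>x. cutoff \<epsilon> (h x)) has_derivative (\<lambda>v. cutoff' \<epsilon> (h x) * h' x v)) (at x)" for x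
    using has_derivative_compose[OF deriv_h cutoff_derivative[OF \<epsilon>, unfolded has_field_derivative_def]]
    by simp
  have dw: "(w i has_derivative w' i x) (at x)" for i x
    unfolding w_def w'_def
    by (intro has_derivative_mult \<psi>' cut bounded_linear_imp_has_derivative bounded_linear_vec_nth)
  have cw: "continuous_on UNIV (\<lambda>x. w' i x v)" for i v
    unfolding w'_def by (intro continuous_intros cont)
  have zero: "(LINT x:G|lborel. w' i x (axis i 1)) = 0" for i
    by (rule integral_directional_derivative_eq_0[OF open_G bounded_G dw cw])
       (simp_all add: frontier_G w_def w'_def)
  have "(\<Sum>i\<in>UNIV. w' i x (axis i 1)) = cutoff \<epsilon> (h x) * (real CARD('n) * \<psi> x + \<psi>' x x)
     + \<psi> x * cutoff' \<epsilon> (h x) * h' x x" for x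
  proof -
    have "\<psi>' x x = (\<Sum>i\<in>UNIV. x $ i * \<psi>' x (axis i 1))" "h' x x = (\<Sum>i\<in>UNIV. x $ i * h' x (axis i 1))"
      using \<psi>'(1) deriv_h has_derivative_linear linear_axis_expansion by blast+
    then show ?thesis
      unfolding w'_def
      by (simp add: sum.distrib sum_distrib_left sum_distrib_right algebra_simps axis_def)
  qed
  then have "(LINT x:G|lborel. cutoff \<epsilon> (h x) * (real CARD('n) * \<psi> x + \<psi>' x x)
     + \<psi> x * cutoff' \<epsilon> (h x) * h' x x) = (LINT x:G|lborel. \<Sum>i\<in>UNIV. w' i x (axis i 1))"
    by simp
  also have "\<dots> = (\<Sum>i\<in>UNIV. LINT x:G|lborel. w' i x (axis i 1))"
    unfolding set_lebesgue_integral_def scaleR_sum_right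
    by (intro Bochner_Integration.integral_sum)
       (use set_integrable_continuous_on_bounded_open[OF open_G bounded_G cw] in \<open>simp add: set_integrable_def\<close>)
  also have "\<dots> = 0" by (simp add: zero)
  finally show ?thesis .
qed

text \<open>The layer integral on the left stands in for the flux: by
  \<open>divergence_cutoff\<close> it is minus the integral of the cut-off divergence, which
  converges by domination because \<open>h\<close> has no zero in \<open>G\<close>.\<close>

lemma divergence_limit:
  fixes \<psi> :: "real^'n \<Rightarrow> real"
  assumes \<psi>: "real_polynomial_function \<psi>"
    and \<psi>': "\<And>x. (\<psi> has_derivative \<psi>' x) (at x)" "\<And>v. real_polynomial_function (\<lambda>x. \<psi>' x v)"
  shows "(\<lambda>k. LINT x:G|lborel. \<psi> x * cutoff' (inv_Suc k) (h x) * h' x x)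
    \<longlonglongrightarrow> - (LINT x:G|lborel. real CARD('n) * \<psi> x + \<psi>' x x)"
proof -
  note ch = real_polynomial_function_continuous_on[OF poly_h]
  note cont = continuous_on_cutoff[OF inv_Suc_pos ch] real_polynomial_function_continuous_on[OF \<psi>]
    real_polynomial_function_continuous_on[OF real_polynomial_function_radial_derivative[OF \<psi>']]
    real_polynomial_function_continuous_on[OF real_polynomial_function_radial_derivative[OF deriv_h poly_h']]
  let ?d = "\<lambda>x. real CARD('n) * \<psi> x + \<psi>' x x"
  have c1: "continuous_on UNIV (\<lambda>x. cutoff (inv_Suc k) (h x) * ?d x)"
    and c2: "continuous_on UNIV (\<lambda>x. \<psi> x * cutoff' (inv_Suc k) (h x) * h' x x)" for k
    by (intro continuous_intros cont)+
  have "(\<lambda>k. LINT x:G|lborel. cutoff (inv_Suc k) (h x) * ?d x) \<longlonglongrightarrow> (LINT x:G|lborel. ?d x)"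
  proof (rule set_integral_dominated_convergence[OF open_G bounded_G, where b = "\<lambda>x. \<bar>?d x\<bar>"])
    show "(\<lambda>k. cutoff (inv_Suc k) (h x) * ?d x) \<longlonglongrightarrow> ?d x" if "x \<in> G" for x
      using tendsto_mult[OF cutoff_tendsto[OF h_nonzero[OF that]] tendsto_const[of "?d x"]] by simp
    show "\<bar>cutoff (inv_Suc k) (h x) * ?d x\<bar> \<le> \<bar>?d x\<bar>" for k x
      using cutoff_bounds[of "inv_Suc k" "h x"] by (simp add: abs_mult mult_left_le_one_le)
  qed (intro c1 continuous_intros cont)+
  moreover have "(LINT x:G|lborel. \<psi> x * cutoff' (inv_Suc k) (h x) * h' x x)
     = - (LINT x:G|lborel. cutoff (inv_Suc k) (h x) * ?d x)" for k
  proof -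
    have "(LINT x:G|lborel. cutoff (inv_Suc k) (h x) * ?d x + \<psi> x * cutoff' (inv_Suc k) (h x) * h' x x)
       = (LINT x:G|lborel. cutoff (inv_Suc k) (h x) * ?d x)
        + (LINT x:G|lborel. \<psi> x * cutoff' (inv_Suc k) (h x) * h' x x)"
      by (intro set_integral_add set_integrable_continuous_on_bounded_open open_G bounded_G c1 c2)
    then show ?thesis using divergence_cutoff[OF inv_Suc_pos \<psi> \<psi>', of k] by simp
  qed
  ultimately show ?thesis by (simp add: tendsto_minus)
qed

text \<open>A field with the factor \<open>h\<close> has no flux: in its layer integral that factor
  tames \<open>cutoff'\<close> through \<open>cutoff'_mult_bound\<close>, so the integral tends to
  zero. With \<open>\<psi>\<close> a monomial this says that the coefficients of \<open>h\<close>
  satisfy the rows.\<close>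

lemma divergence_multiple:
  fixes \<psi> :: "real^'n \<Rightarrow> real"
  assumes \<psi>: "real_polynomial_function \<psi>"
    and \<psi>': "\<And>x. (\<psi> has_derivative \<psi>' x) (at x)" "\<And>v. real_polynomial_function (\<lambda>x. \<psi>' x v)"
  shows "(LINT x:G|lborel. real CARD('n) * (\<psi> x * h x) + (\<psi> x * h' x x + \<psi>' x x * h x)) = 0"
proof -
  note ch = real_polynomial_function_continuous_on[OF poly_h]
  note cont = ch continuous_on_cutoff[OF inv_Suc_pos ch] real_polynomial_function_continuous_on[OF \<psi>]
    real_polynomial_function_continuous_on[OF real_polynomial_function_radial_derivative[OF deriv_h poly_h']]
  have "(\<lambda>k. LINT x:G|lborel. (\<psi> x * h x) * cutoff' (inv_Suc k) (h x) * h' x x)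
    \<longlonglongrightarrow> - (LINT x:G|lborel. real CARD('n) * (\<psi> x * h x) + (\<psi> x * h' x x + \<psi>' x x * h x))"
    by (rule divergence_limit[of _ "\<lambda>x v. \<psi> x * h' x v + \<psi>' x v * h x"])
       (intro has_derivative_mult \<psi> \<psi>' deriv_h poly_h' poly_h real_polynomial_function.intros(3,4))+
  moreover have "(\<lambda>k. LINT x:G|lborel. (\<psi> x * h x) * cutoff' (inv_Suc k) (h x) * h' x x)
    \<longlonglongrightarrow> (LINT x:G|lborel. 0)"
  proof (rule set_integral_dominated_convergence[OF open_G bounded_G, where b = "\<lambda>x. \<bar>\<psi> x * h' x x\<bar>"])
    show "(\<lambda>k. (\<psi> x * h x) * cutoff' (inv_Suc k) (h x) * h' x x) \<longlonglongrightarrow> 0" if "x \<in> G" for x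
      using tendsto_mult[OF tendsto_mult[OF tendsto_const[of "\<psi> x * h x"] cutoff'_tendsto[OF h_nonzero[OF that]]]
          tendsto_const[of "h' x x"]] by simp
    show "\<bar>(\<psi> x * h x) * cutoff' (inv_Suc k) (h x) * h' x x\<bar> \<le> \<bar>\<psi> x * h' x x\<bar>" for k x
    proof -
      have "\<bar>(\<psi> x * h x) * cutoff' (inv_Suc k) (h x) * h' x x\<bar>
          = \<bar>\<psi> x * h' x x\<bar> * \<bar>h x * cutoff' (inv_Suc k) (h x)\<bar>" by (simp add: abs_mult)
      also have "\<dots> \<le> \<bar>\<psi> x * h' x x\<bar> * 1" by (intro mult_left_mono cutoff'_mult_bound) simp
      finally show ?thesis by simp
    qed
  qed (intro continuous_intros cont)+
  ultimately show ?thesis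
    using LIMSEQ_unique by (fastforce simp: set_lebesgue_integral_def)
qed

end

context polynomial_frontier
begin

text \<open>The mass that \<open>cutoff'\<close> puts on a thin layer of \<open>G\<close> along its frontier does not tend to zero at
  a frontier point \<open>x0\<close> where the frontier is transversal to \<open>v\<close>: integrate over the translates of a
  ball at \<open>x0\<close> in the direction \<open>v\<close>, and exchange the integrals.\<close>

lemma layer_mass_bounded_below:
  fixes f :: "real^'n \<Rightarrow> real"
  assumes pos: "\<And>x. x \<in> G \<Longrightarrow> 0 < h x"
    and f: "continuous_on UNIV f" "\<And>x. 0 \<le> f x" "0 < f x0"
    and x0: "h x0 = 0" "0 < h' x0 v"
  shows "\<exists>c>0. \<exists>\<eta>>0. \<forall>\<epsilon>. 0 < \<epsilon> \<longrightarrow> \<epsilon> \<le> \<eta> \<longrightarrow> c \<le> (LINT x:G|lborel. f x * cutoff' \<epsilon> (h x))"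
proof -
  note ch = real_polynomial_function_continuous_on[OF poly_h]
  have ch': "continuous_on UNIV (\<lambda>x. h' x v)"
    by (rule real_polynomial_function_continuous_on[OF poly_h'])
  \<comment> \<open>On \<open>W\<close> one has \<open>b < f x\<close> and
    \<open>h' x v < C\<close>, so inside the box, where \<open>h' x v\<close> is positive,
    \<open>f x * cutoff' \<epsilon> (h x)\<close> dominates \<open>b / C\<close> times
    \<open>cutoff' \<epsilon> (h x) * h' x v\<close> wherever \<open>h\<close> is nonnegative. The
    latter is an exact derivative along \<open>v\<close>.\<close>
  define b where "b = f x0 / 2"
  define C where "C = h' x0 v + 1"
  have b: "0 < b" and C: "0 < C" using f(3) x0(2) by (auto simp: b_def C_def)
  define W where "W = {x. b < f x} \<inter> {x. h' x v < C}"
  have "open W" unfolding W_def by (intro open_Int open_Collect_less continuous_intros f ch')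
  moreover have "x0 \<in> W" using f(3) by (simp add: W_def b_def C_def)
  ultimately obtain \<tau> \<rho> \<eta> where \<tau>: "0 < \<tau>" and \<rho>: "0 < \<rho>" and \<eta>: "0 < \<eta>"
    and W: "\<And>x s. x \<in> ball x0 \<rho> \<Longrightarrow> \<bar>s\<bar> \<le> \<tau> \<Longrightarrow> x + s *\<^sub>R v \<in> W \<and> 0 < h' (x + s *\<^sub>R v) v"
    and top: "\<And>x. x \<in> ball x0 \<rho> \<Longrightarrow> \<eta> \<le> h (x + \<tau> *\<^sub>R v)"
    and bot: "\<And>x. x \<in> ball x0 \<rho> \<Longrightarrow> h (x - \<tau> *\<^sub>R v) \<le> - \<eta>"
    and inG: "\<And>x s. x \<in> ball x0 \<rho> \<Longrightarrow> \<bar>s\<bar> \<le> \<tau> \<Longrightarrow> 0 < h (x + s *\<^sub>R v) \<Longrightarrow>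
       x + s *\<^sub>R v \<in> G \<longleftrightarrow> x0 + \<tau> *\<^sub>R v \<in> G"
    by (rule transversal_flow_box[OF frontier_G deriv_h ch' x0]) (rule that)
  \<comment> \<open>Points of \<open>G\<close> occur arbitrarily near \<open>x0\<close> and have
    positive \<open>h\<close>, so the positive side of the box is the one inside
    \<open>G\<close>.\<close>
  have topG: "x0 + \<tau> *\<^sub>R v \<in> G"
  proof -
    have "x0 \<in> closure G" using x0(1) frontier_G by (auto simp: frontier_def)
    then obtain y where y: "y \<in> G" "y \<in> ball x0 \<rho>"
      using \<rho> by (metis closure_approachable dist_commute mem_ball)
    then show ?thesis using inG[OF y(2), of 0] \<tau> pos by simp
  qed
  define vol where "vol = measure lborel (ball x0 \<rho>)"
  have vol: "0 < vol" unfolding vol_def using \<rho> by (rule content_ball_pos)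
  \<comment> \<open>The lower bound \<open>b / (2 * C)\<close> per ray, times the volume of the
    ball, divided by the length \<open>2 * \<tau>\<close> of the range of translations.\<close>
  define c where "c = b * vol / (4 * C * \<tau>)"
  have c: "0 < c" unfolding c_def using b vol C \<tau> by simp
  have "c \<le> (LINT x:G|lborel. f x * cutoff' \<epsilon> (h x))" if \<epsilon>: "0 < \<epsilon>" "\<epsilon> \<le> \<eta>" for \<epsilon>
  proof -
    define K where "K = (\<lambda>x. indicator G x * (f x * cutoff' \<epsilon> (h x)))"
    have Knn: "0 \<le> K x" for x
      using f(2) pos cutoff'_nonneg[of "h x" \<epsilon>] by (auto simp: K_def indicator_def less_imp_le)
    have "set_integrable lborel G (\<lambda>x. f x * cutoff' \<epsilon> (h x))"
      by (intro set_integrable_continuous_on_bounded_open open_G bounded_G continuous_intros f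
          continuous_on_cutoff \<epsilon> ch)
    then have Ki: "integrable lborel K" by (simp add: K_def set_integrable_def)
    then have Km [measurable]: "K \<in> borel_measurable borel" by (auto dest: borel_measurable_integrable)
    have KI: "(\<integral>\<^sup>+ x. ennreal (K x) \<partial>lborel) = ennreal (LINT x:G|lborel. f x * cutoff' \<epsilon> (h x))"
      using nn_integral_eq_integral[OF Ki] Knn by (simp add: K_def set_lebesgue_integral_def)
    \<comment> \<open>From the crossing \<open>s0\<close> up to \<open>\<tau>\<close> the value of
      \<open>cutoff \<epsilon>\<close> rises from 0 to at least 1/2, because \<open>h\<close> is at
      least \<open>\<eta>\<close>, hence at least \<open>\<epsilon>\<close>, at the end.\<close>
    have ray: "ennreal (b / (2 * C)) \<le> (\<integral>\<^sup>+ s. ennreal (K (x + s *\<^sub>R v)) * indicator {-\<tau>..\<tau>} s \<partial>lborel)"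
      if x: "x \<in> ball x0 \<rho>" for x
    proof -
      have "\<exists>s\<ge>-\<tau>. s \<le> \<tau> \<and> h (x + s *\<^sub>R v) = 0"
        using bot[OF x] top[OF x] \<eta> \<tau>
        by (intro IVT' continuous_on_compose2[OF ch] continuous_intros) auto
      then obtain s0 where s0: "-\<tau> \<le> s0" "s0 \<le> \<tau>" "h (x + s0 *\<^sub>R v) = 0" by blast
      have hpos: "0 \<le> h (x + s *\<^sub>R v)" "s0 < s \<Longrightarrow> 0 < h (x + s *\<^sub>R v)" if "s0 \<le> s" "s \<le> \<tau>" for s
      proof -
        show P: "0 < h (x + s *\<^sub>R v)" if "s0 < s"
        proof -
          have "h (x + s0 *\<^sub>R v) < h (x + s *\<^sub>R v)"
          proof (rule DERIV_pos_imp_increasing[OF that])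
            fix u assume "s0 \<le> u" "u \<le> s"
            then show "\<exists>y. ((\<lambda>s. h (x + s *\<^sub>R v)) has_real_derivative y) (at u) \<and> 0 < y"
              using has_real_derivative_along_line[OF deriv_h, of x v u] W[OF x, of u] s0 \<open>s \<le> \<tau>\<close> by auto
          qed
          then show ?thesis using s0 by simp
        qed
        then show "0 \<le> h (x + s *\<^sub>R v)" using s0(3) that by (cases "s = s0") auto
      qed
      define d where "d = (\<lambda>s. b / C * (cutoff' \<epsilon> (h (x + s *\<^sub>R v)) * h' (x + s *\<^sub>R v) v))"
      have "continuous_on UNIV d" unfolding d_def
        by (intro continuous_intros continuous_on_cutoff \<epsilon> continuous_on_compose2[OF ch]
            continuous_on_compose2[OF ch']) auto
      then have dm: "d \<in> borel_measurable borel" by (rule borel_measurable_continuous_onI)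
      have "(\<integral>\<^sup>+ s. ennreal (d s) * indicator {s0..\<tau>} s \<partial>lborel)
         = ennreal (b / C * cutoff \<epsilon> (h (x + \<tau> *\<^sub>R v)) - b / C * cutoff \<epsilon> (h (x + s0 *\<^sub>R v)))"
      proof (rule nn_integral_FTC_Icc[OF dm])
        fix s assume "s \<in> {s0..\<tau>}"
        then have s: "s0 \<le> s" "s \<le> \<tau>" by auto
        then have "\<bar>s\<bar> \<le> \<tau>" using s0 by simp
        then show "0 \<le> d s"
          using W[OF x, of s] hpos(1)[OF s] b C cutoff'_nonneg unfolding d_def
          by (intro mult_nonneg_nonneg) (auto simp: less_imp_le)
        show "((\<lambda>s. b / C * cutoff \<epsilon> (h (x + s *\<^sub>R v))) has_real_derivative d s) (at s)"
          unfolding d_def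
          by (intro DERIV_cmult DERIV_chain2[OF cutoff_derivative[OF \<epsilon>(1)]] has_real_derivative_along_line deriv_h)
      qed (use s0 in auto)
      also have "\<dots> = ennreal (b / C * cutoff \<epsilon> (h (x + \<tau> *\<^sub>R v)))" using s0 by simp
      finally have FTC: "(\<integral>\<^sup>+ s. ennreal (d s) * indicator {s0..\<tau>} s \<partial>lborel)
         = ennreal (b / C * cutoff \<epsilon> (h (x + \<tau> *\<^sub>R v)))" .
      have "1 / 2 \<le> cutoff \<epsilon> (h (x + \<tau> *\<^sub>R v))"
        using cutoff_ge_half[OF \<epsilon>(1)] \<epsilon>(2) top[OF x] by simp
      then have "b / C * (1 / 2) \<le> b / C * cutoff \<epsilon> (h (x + \<tau> *\<^sub>R v))"
        using b C by (intro mult_left_mono) auto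
      then have "ennreal (b / (2 * C)) \<le> ennreal (b / C * cutoff \<epsilon> (h (x + \<tau> *\<^sub>R v)))"
        by (intro ennreal_leI) (simp add: field_simps)
      also have "\<dots> = (\<integral>\<^sup>+ s. ennreal (d s) * indicator {s0..\<tau>} s \<partial>lborel)" by (rule FTC[symmetric])
      also have "\<dots> \<le> (\<integral>\<^sup>+ s. ennreal (K (x + s *\<^sub>R v)) * indicator {-\<tau>..\<tau>} s \<partial>lborel)"
      proof (rule nn_integral_mono)
        fix s
        show "ennreal (d s) * indicator {s0..\<tau>} s \<le> ennreal (K (x + s *\<^sub>R v)) * indicator {-\<tau>..\<tau>} s"
        proof (cases "s \<in> {s0..\<tau>}")
          case True
          then have s: "\<bar>s\<bar> \<le> \<tau>" "s0 \<le> s" "s \<le> \<tau>" using s0 by auto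
          have "d s \<le> K (x + s *\<^sub>R v)"
          proof (cases "s = s0")
            case True
            then show ?thesis using s0(3) Knn by (simp add: d_def)
          next
            case False
            then have hp: "0 < h (x + s *\<^sub>R v)" using hpos(2) s by simp
            then have "x + s *\<^sub>R v \<in> G" using inG[OF x s(1)] topG by blast
            moreover have "d s \<le> f (x + s *\<^sub>R v) * cutoff' \<epsilon> (h (x + s *\<^sub>R v))"
            proof -
              have "b < f (x + s *\<^sub>R v)" "h' (x + s *\<^sub>R v) v < C" "0 < h' (x + s *\<^sub>R v) v"
                using W[OF x s(1)] by (auto simp: W_def)
              then have "b / C * h' (x + s *\<^sub>R v) v \<le> f (x + s *\<^sub>R v) * 1"
                using b C mult_mono[of b "f (x + s *\<^sub>R v)" "h' (x + s *\<^sub>R v) v / C" 1] by simp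
              then have "b / C * h' (x + s *\<^sub>R v) v * cutoff' \<epsilon> (h (x + s *\<^sub>R v))
                 \<le> f (x + s *\<^sub>R v) * 1 * cutoff' \<epsilon> (h (x + s *\<^sub>R v))"
                using cutoff'_nonneg[of "h (x + s *\<^sub>R v)" \<epsilon>] hp by (intro mult_right_mono) auto
              then show ?thesis by (simp add: d_def mult_ac)
            qed
            ultimately show ?thesis by (simp add: K_def)
          qed
          then show ?thesis using True s by (simp add: ennreal_leI)
        qed simp
      qed
      finally show ?thesis .
    qed
    \<comment> \<open>The ray bound is integrated over the ball. After the exchange, the integral
      over all \<open>x\<close> no longer depends on the translation by \<open>s\<close>, and
      \<open>s\<close> runs through an interval of length \<open>2 * \<tau>\<close>.\<close>
    let ?F = "\<lambda>x s. ennreal (K (x + s *\<^sub>R v)) * indicator {-\<tau>..\<tau>} s"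
    have "ennreal (b / (2 * C) * vol) = (\<integral>\<^sup>+ x. ennreal (b / (2 * C)) * indicator (ball x0 \<rho>) x \<partial>lborel)"
    proof -
      have "emeasure lborel (ball x0 \<rho>) = ennreal vol"
        unfolding vol_def using emeasure_lborel_ball_finite[of x0 \<rho>]
        by (intro emeasure_eq_ennreal_measure) auto
      then show ?thesis using b C by (simp add: nn_integral_cmult_indicator flip: ennreal_mult')
    qed
    also have "\<dots> \<le> (\<integral>\<^sup>+ x. (\<integral>\<^sup>+ s. ?F x s \<partial>lborel) \<partial>lborel)"
      using ray by (intro nn_integral_mono) (auto simp: indicator_def)
    also have "\<dots> = (\<integral>\<^sup>+ s. (\<integral>\<^sup>+ x. ?F x s \<partial>lborel) \<partial>lborel)"
      by (rule lborel_pair.Fubini'[symmetric]) measurable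
    also have "\<dots> = (\<integral>\<^sup>+ s. (\<integral>\<^sup>+ x. ennreal (K x) \<partial>lborel) * indicator {-\<tau>..\<tau>} (s::real) \<partial>lborel)"
    proof (rule nn_integral_cong)
      fix s :: real
      have "(\<integral>\<^sup>+ x. ?F x s \<partial>lborel) = (\<integral>\<^sup>+ x. ennreal (K (s *\<^sub>R v + x)) \<partial>lborel) * indicator {-\<tau>..\<tau>} s"
        by (subst nn_integral_multc) (auto simp: add.commute)
      also have "(\<integral>\<^sup>+ x. ennreal (K (s *\<^sub>R v + x)) \<partial>lborel) = (\<integral>\<^sup>+ x. ennreal (K x) \<partial>distr lborel borel ((+) (s *\<^sub>R v)))"
        by (subst nn_integral_distr) auto
      also have "\<dots> = (\<integral>\<^sup>+ x. ennreal (K x) \<partial>lborel)" by (simp add: lborel_distr_plus)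
      finally show "(\<integral>\<^sup>+ x. ?F x s \<partial>lborel) = (\<integral>\<^sup>+ x. ennreal (K x) \<partial>lborel) * indicator {-\<tau>..\<tau>} s" .
    qed
    also have "\<dots> = ennreal ((LINT x:G|lborel. f x * cutoff' \<epsilon> (h x)) * (2 * \<tau>))"
      using \<tau> by (simp add: nn_integral_cmult_indicator KI ennreal_mult'')
    finally have le: "ennreal (b / (2 * C) * vol) \<le> ennreal ((LINT x:G|lborel. f x * cutoff' \<epsilon> (h x)) * (2 * \<tau>))" .
    have "0 \<le> (LINT x:G|lborel. f x * cutoff' \<epsilon> (h x))"
      using Bochner_Integration.integral_nonneg[of lborel K, OF Knn]
      by (simp add: K_def set_lebesgue_integral_def)
    then have "b / (2 * C) * vol \<le> (LINT x:G|lborel. f x * cutoff' \<epsilon> (h x)) * (2 * \<tau>)"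
      using le \<tau> by (subst (asm) ennreal_le_iff) auto
    then show ?thesis using \<tau> C by (simp add: c_def field_simps)
  qed
  then show ?thesis using c \<eta> by blast
qed

text \<open>For this field the layer integrand is the square of \<open>q x * h' x x\<close> times
  \<open>cutoff'\<close>, hence nonnegative on \<open>G\<close>, and its integral tends to zero.
  Where the square is positive at a frontier point, \<open>x0\<close> or \<open>- x0\<close> is a
  transversal direction, and the layer mass would stay bounded below.\<close>

lemma divergence_zero_imp_vanishing:
  fixes q :: "real^'n \<Rightarrow> real"
  assumes pos: "\<And>x. x \<in> G \<Longrightarrow> 0 < h x" and q: "real_polynomial_function q"
    and \<psi>': "\<And>x. ((\<lambda>x. (q x)\<^sup>2 * h' x x) has_derivative \<psi>' x) (at x)"
      "\<And>v. real_polynomial_function (\<lambda>x. \<psi>' x v)"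
    and zero: "(LINT x:G|lborel. real CARD('n) * ((q x)\<^sup>2 * h' x x) + \<psi>' x x) = 0"
    and x0: "h x0 = 0"
  shows "q x0 * h' x0 x0 = 0"
proof (rule ccontr)
  assume ne: "q x0 * h' x0 x0 \<noteq> 0"
  note pE = real_polynomial_function_radial_derivative[OF deriv_h poly_h']
  define f where "f = (\<lambda>x. (q x * h' x x)\<^sup>2)"
  have "continuous_on UNIV f" unfolding f_def
    by (intro continuous_intros real_polynomial_function_continuous_on q pE)
  moreover have "0 < f x0" using ne by (simp add: f_def)
  moreover obtain v where "0 < h' x0 v"
  proof -
    have "h' x0 (- x0) = - h' x0 x0"
      using deriv_h[of x0] by (simp add: has_derivative_linear linear_neg)
    then show ?thesis
      using ne that by (metis linorder_neqE_linordered_idom mult_zero_right neg_0_less_iff_less)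
  qed
  ultimately have "\<exists>c>0. \<exists>\<eta>>0. \<forall>\<epsilon>. 0 < \<epsilon> \<longrightarrow> \<epsilon> \<le> \<eta> \<longrightarrow> c \<le> (LINT x:G|lborel. f x * cutoff' \<epsilon> (h x))"
    by (intro layer_mass_bounded_below[OF pos _ _ _ x0]) (auto simp: f_def)
  then obtain c \<eta> where c: "0 < c" "0 < \<eta>"
    "\<And>\<epsilon>. 0 < \<epsilon> \<Longrightarrow> \<epsilon> \<le> \<eta> \<Longrightarrow> c \<le> (LINT x:G|lborel. f x * cutoff' \<epsilon> (h x))"
    by blast
  have "(\<lambda>k. LINT x:G|lborel. (q x)\<^sup>2 * h' x x * cutoff' (inv_Suc k) (h x) * h' x x) \<longlonglongrightarrow> 0"
    using divergence_limit[OF real_polynomial_function.intros(4)[OF real_polynomial_function_power[OF q] pE] \<psi>']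
    unfolding zero by simp
  then have "(\<lambda>k. LINT x:G|lborel. f x * cutoff' (inv_Suc k) (h x)) \<longlonglongrightarrow> 0"
    by (simp add: f_def power2_eq_square mult_ac)
  then have "eventually (\<lambda>k. (LINT x:G|lborel. f x * cutoff' (inv_Suc k) (h x)) < c) sequentially"
    using c(1) by (auto dest: order_tendstoD)
  moreover have "eventually (\<lambda>k. inv_Suc k < \<eta>) sequentially"
    using inv_Suc_tendsto_0 c(2) by (auto dest: order_tendstoD)
  ultimately have "eventually (\<lambda>k. False) sequentially"
  proof eventually_elim
    case (elim k)
    then show ?case using c(3)[OF inv_Suc_pos, of k] by simp
  qed
  then show False by simp
qed

end

section \<open>The moment system\<close>

text \<open>Euler's identity for homogeneous functions: differentiate along t x at t = 1, where each
  monomial scales by a power of t.\<close>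

lemma mmonom_sum_Euler:
  assumes "((\<lambda>x. \<Sum>a\<in>A. r a * mmonom (\<alpha> a) x) has_derivative D) (at x)"
  shows "D x = (\<Sum>a\<in>A. r a * real (mdeg (\<alpha> a)) * mmonom (\<alpha> a) x)"
proof -
  have "((\<lambda>t::real. t *\<^sub>R x) has_derivative (\<lambda>t. t *\<^sub>R x)) (at 1)"
    by (auto intro!: derivative_eq_intros)
  then have "((\<lambda>t::real. \<Sum>a\<in>A. r a * mmonom (\<alpha> a) (t *\<^sub>R x)) has_derivative (\<lambda>t. D (t *\<^sub>R x))) (at 1)"
    by (rule has_derivative_compose) (simp add: assms)
  moreover have "((\<lambda>t::real. \<Sum>a\<in>A. r a * mmonom (\<alpha> a) (t *\<^sub>R x)) has_derivative
      (\<lambda>t. \<Sum>a\<in>A. t * (r a * real (mdeg (\<alpha> a)) * mmonom (\<alpha> a) x))) (at 1)"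
    unfolding mmonom_scaleR by (auto intro!: derivative_eq_intros simp: mult_ac)
  ultimately have "(\<lambda>t. D (t *\<^sub>R x)) = (\<lambda>t. \<Sum>a\<in>A. t * (r a * real (mdeg (\<alpha> a)) * mmonom (\<alpha> a) x))"
    by (rule has_derivative_unique)
  from fun_cong[OF this, of 1] show ?thesis by simp
qed

lemma moment_eq_set_integral:
  assumes "open G" "bounded G"
  shows "moment G \<alpha> = (LINT x:G|lborel. mmonom \<alpha> x)"
  unfolding moment_def
  by (rule set_borel_integral_eq_integral(2)[symmetric])
     (intro set_integrable_continuous_on_bounded_open assms real_polynomial_function_continuous_on
       real_polynomial_function_mmonom)

lemma set_integral_sum_continuous:
  fixes f :: "'b \<Rightarrow> 'a::euclidean_space \<Rightarrow> real"
  assumes "open G" "bounded G" "\<And>a. a \<in> A \<Longrightarrow> continuous_on UNIV (f a)"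
  shows "(LINT x:G|lborel. \<Sum>a\<in>A. c a * f a x) = (\<Sum>a\<in>A. c a * (LINT x:G|lborel. f a x))"
proof -
  have "integrable lborel (\<lambda>x. indicator G x *\<^sub>R (c a * f a x))" if "a \<in> A" for a
    using set_integrable_continuous_on_bounded_open[OF assms(1,2) continuous_on_mult_left[OF assms(3)[OF that]]]
    by (simp add: set_integrable_def)
  then have "(LINT x:G|lborel. \<Sum>a\<in>A. c a * f a x) = (\<Sum>a\<in>A. LINT x:G|lborel. c a * f a x)"
    unfolding set_lebesgue_integral_def scaleR_sum_right by (intro Bochner_Integration.integral_sum)
  then show ?thesis by simp
qed

text \<open>With F the polynomial with coefficients \<open>f\<close>, the integrand is the
  divergence of \<open>mmonom \<alpha> x\<close> times F(x) x, by Euler's identity. The left side is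
  a row of the system multiplied by \<open>CARD('n) + mdeg \<alpha>\<close>.\<close>

lemma moment_sum_eq_divergence:
  fixes f :: "('n::finite \<Rightarrow> nat) \<Rightarrow> real"
  assumes "open G" "bounded G"
  shows "(\<Sum>\<beta>\<in>S. real (CARD('n) + mdeg \<alpha> + mdeg \<beta>) * moment G (\<lambda>i. \<alpha> i + \<beta> i) * f \<beta>)
    = (LINT x:G|lborel. mmonom \<alpha> x * (real (CARD('n) + mdeg \<alpha>) * (\<Sum>\<beta>\<in>S. f \<beta> * mmonom \<beta> x)
        + (\<Sum>\<beta>\<in>S. f \<beta> * real (mdeg \<beta>) * mmonom \<beta> x)))"
proof -
  have "(\<Sum>\<beta>\<in>S. real (CARD('n) + mdeg \<alpha> + mdeg \<beta>) * moment G (\<lambda>i. \<alpha> i + \<beta> i) * f \<beta>)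
     = (\<Sum>\<beta>\<in>S. (real (CARD('n) + mdeg \<alpha> + mdeg \<beta>) * f \<beta>) * (LINT x:G|lborel. mmonom (\<lambda>i. \<alpha> i + \<beta> i) x))"
    by (simp add: moment_eq_set_integral[OF assms] mult_ac)
  also have "\<dots> = (LINT x:G|lborel. \<Sum>\<beta>\<in>S. (real (CARD('n) + mdeg \<alpha> + mdeg \<beta>) * f \<beta>) * mmonom (\<lambda>i. \<alpha> i + \<beta> i) x)"
    by (intro set_integral_sum_continuous[symmetric] assms real_polynomial_function_continuous_on
       real_polynomial_function_mmonom)
  also have "\<dots> = (LINT x:G|lborel. mmonom \<alpha> x * (real (CARD('n) + mdeg \<alpha>) * (\<Sum>\<beta>\<in>S. f \<beta> * mmonom \<beta> x)
        + (\<Sum>\<beta>\<in>S. f \<beta> * real (mdeg \<beta>) * mmonom \<beta> x)))"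
    by (intro arg_cong[where f = "set_lebesgue_integral lborel G"] ext)
       (simp add: sum_distrib_left mmonom_add distrib_left distrib_right sum.distrib mult_ac)
  finally show ?thesis .
qed

text \<open>On the ray t x the restriction \<open>P\<close> of \<open>H\<close> is nonzero because
  \<open>H 0\<close> is, and it has a root at t = 1. There its order exceeds that of
  \<open>pderiv P\<close> by one, and the factor t from the radial derivative contributes no order;
  the missing order must come from \<open>Q\<close>.\<close>

lemma zero_of_radial_derivative_multiple:
  fixes H :: "'a::real_normed_vector \<Rightarrow> real"
  assumes H: "real_polynomial_function H" "H 0 \<noteq> 0" "\<And>x. (H has_derivative H' x) (at x)"
    and Q: "real_polynomial_function Q" and s: "real_polynomial_function s"
    and eq: "\<And>x. Q x * H' x x = H x * s x" and x: "H x = 0"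
  shows "Q x = 0"
proof (rule ccontr)
  assume Qx: "Q x \<noteq> 0"
  obtain P q S where P: "\<And>t. poly P t = H (0 + t *\<^sub>R x)" and q: "\<And>t. poly q t = Q (0 + t *\<^sub>R x)"
    and S: "\<And>t. poly S t = s (0 + t *\<^sub>R x)"
    using real_polynomial_function_on_line[OF H(1), of 0 x] real_polynomial_function_on_line[OF Q, of 0 x]
      real_polynomial_function_on_line[OF s, of 0 x] by blast
  have "poly (pderiv P) t = H' (0 + t *\<^sub>R x) x" for t
    using poly_DERIV[of P t] has_real_derivative_along_line[OF H(3), of 0 x t] unfolding P
    by (rule DERIV_unique)
  moreover have "H' (t *\<^sub>R x) (t *\<^sub>R x) = t * H' (t *\<^sub>R x) x" for t
    using H(3)[of "t *\<^sub>R x"] by (simp add: has_derivative_linear linear_scale)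
  ultimately have "poly (q * ([:0, 1:] * pderiv P)) t = poly (P * S) t" for t
    using eq[of "t *\<^sub>R x"] by (simp add: P q S mult_ac)
  then have eqP: "q * ([:0, 1:] * pderiv P) = P * S"
    using poly_eq_poly_eq_iff by blast
  have P0: "P \<noteq> 0" using H(2) P[of 0] by auto
  have P1: "poly P 1 = 0" using x P[of 1] by simp
  have ord: "order 1 P = Suc (order 1 (pderiv P))" by (rule order_pderiv[OF P0 P1])
  have pd: "pderiv P \<noteq> 0"
    using P0 P1 by (metis degree_eq_zeroE pderiv_eq_0_iff poly_pCons poly_0 mult_zero_right
        add.right_neutral pCons_0_0)
  have q1: "poly q 1 \<noteq> 0" using Qx q[of 1] by simp
  then have "q \<noteq> 0" by auto
  then have nz: "q * ([:0, 1:] * pderiv P) \<noteq> 0" using pd by simp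
  then have nz': "[:0, 1:] * pderiv P \<noteq> 0" by auto
  have "order 1 (q * ([:0, 1:] * pderiv P)) = order 1 (pderiv P)"
    unfolding order_mult[OF nz] order_mult[OF nz'] using order_0I[OF q1] order_0I[of "[:0,1:]" "1::real"] by simp
  moreover have "order 1 (P * S) = order 1 P + order 1 S"
    using nz unfolding eqP by (rule order_mult)
  ultimately show False using ord unfolding eqP by simp
qed

text \<open>On a ray through a point where the top form of \<open>h\<close> is nonzero,
  \<open>h\<close> has degree exactly \<open>d\<close> and \<open>q\<close> at most
  \<open>d\<close>, so the cofactor is constant or zero. At t = 0 the polynomial \<open>q\<close>
  vanishes and \<open>h\<close> does not, so the cofactor is zero; such points are generic.\<close>

lemma mpoly_multiple_eq_0:
  fixes h q :: "('n::finite \<Rightarrow> nat) \<Rightarrow> real"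
  assumes h: "\<And>\<alpha>. h \<alpha> \<noteq> 0 \<Longrightarrow> mdeg \<alpha> \<le> d" "h \<alpha>0 \<noteq> 0" "mdeg \<alpha>0 = d" "mpoly_eval h 0 \<noteq> 0"
    and q: "\<And>\<alpha>. q \<alpha> \<noteq> 0 \<Longrightarrow> mdeg \<alpha> \<le> d" "q (\<lambda>_. 0) = 0"
    and s: "real_polynomial_function s" "\<And>x. mpoly_eval q x = mpoly_eval h x * s x"
  shows "q \<alpha> = 0"
proof -
  let ?S = "{\<alpha>::'n \<Rightarrow> nat. mdeg \<alpha> \<le> d}"
  have evq: "mpoly_eval q x = (\<Sum>\<alpha>\<in>?S. q \<alpha> * mmonom \<alpha> x)" for x
    using q by (intro mpoly_eval_eq_sum finite_mdeg_le) auto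
  have evh: "mpoly_eval h x = (\<Sum>\<alpha>\<in>?S. h \<alpha> * mmonom \<alpha> x)" for x
    using h by (intro mpoly_eval_eq_sum finite_mdeg_le) auto
  have pq: "real_polynomial_function (mpoly_eval q)"
    using q by (intro real_polynomial_function_mpoly_eval is_mpolyI[OF finite_mdeg_le[of d]]) auto
  define T where "T = (\<lambda>x. \<Sum>\<alpha>\<in>{\<alpha>. mdeg \<alpha> = d}. h \<alpha> * mmonom \<alpha> x)"
  have finT: "finite {\<alpha>::'n \<Rightarrow> nat. mdeg \<alpha> = d}"
    by (rule finite_subset[OF _ finite_mdeg_le[of d]]) auto
  have pT: "real_polynomial_function T" unfolding T_def
    by (intro real_polynomial_function_sum finT real_polynomial_function.intros(2,4)
        real_polynomial_function_mmonom)
  obtain a where a: "T a \<noteq> 0"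
    using mmonom_independent[OF finT, of h \<alpha>0] h(2,3) unfolding T_def by auto
  have zero: "mpoly_eval q x = 0" if "T x \<noteq> 0" for x
  proof -
    define P where "P = (\<Sum>\<alpha>\<in>?S. monom (h \<alpha> * mmonom \<alpha> x) (mdeg \<alpha>))"
    define R where "R = (\<Sum>\<alpha>\<in>?S. monom (q \<alpha> * mmonom \<alpha> x) (mdeg \<alpha>))"
    obtain U where U: "\<And>t. poly U t = s (0 + t *\<^sub>R x)"
      using real_polynomial_function_on_line[OF s(1)] by blast
    have P: "poly P t = mpoly_eval h (t *\<^sub>R x)" for t
      by (simp add: P_def evh poly_sum poly_monom mmonom_scaleR mult_ac)
    have R: "poly R t = mpoly_eval q (t *\<^sub>R x)" for t
      by (simp add: R_def evq poly_sum poly_monom mmonom_scaleR mult_ac)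
    have "poly R t = poly (P * U) t" for t by (simp add: P R U s(2))
    then have RPU: "R = P * U" using poly_eq_poly_eq_iff by blast
    have "coeff P d = T x"
      unfolding P_def T_def coeff_sum coeff_monom
      by (simp add: sum.If_cases[OF finite_mdeg_le] Int_def) (intro sum.cong, auto)
    then have dP: "d \<le> degree P" "P \<noteq> 0" using that by (auto intro: le_degree)
    have dR: "degree R \<le> d" unfolding R_def
      by (intro degree_sum_le finite_mdeg_le) (auto intro: order_trans[OF degree_monom_le])
    have "coeff R 0 = q (\<lambda>_. 0) * mmonom (\<lambda>_. 0) x"
    proof -
      have "coeff R 0 = (\<Sum>\<alpha>\<in>{\<lambda>_. 0}. q \<alpha> * mmonom \<alpha> x)"
        unfolding R_def coeff_sum coeff_monom
        by (simp add: sum.If_cases[OF finite_mdeg_le] mdeg_eq_0_iff Int_def cong: conj_cong)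
           (simp add: mdeg_def)
      then show ?thesis by simp
    qed
    then have "poly R 0 = 0" using q(2) by (simp add: poly_0_coeff_0)
    moreover have "poly P 0 \<noteq> 0" using h(4) by (simp add: P)
    ultimately have U0: "poly U 0 = 0" using RPU by simp
    have "U = 0"
    proof (rule ccontr)
      assume "U \<noteq> 0"
      then have "degree P + degree U \<le> d" using dR dP(2) unfolding RPU by (simp add: degree_mult_eq)
      then have "degree U = 0" using dP(1) by simp
      then show False using U0 \<open>U \<noteq> 0\<close> by (metis degree_eq_zeroE mult_zero_left poly_pCons add.right_neutral pCons_0_0)
    qed
    then show ?thesis using R[of 1] RPU by simp
  qed
  have "mpoly_eval q x = 0" for x
    using real_polynomial_function_mult_nonzero[OF pT a pq, of x] zero by auto
  then show ?thesis
    using mmonom_independent[OF finite_mdeg_le[of d], of q \<alpha>] q(1)[of \<alpha>] unfolding evq by blast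
qed

lemma moment_kernel_trivial:
  fixes G :: "(real^'n::finite) set" and h q :: "('n \<Rightarrow> nat) \<Rightarrow> real"
  assumes G: "open G" "bounded G" "frontier G = {x. mpoly_eval h x = 0}"
    and pos: "\<And>x. x \<in> G \<Longrightarrow> 0 < mpoly_eval h x"
    and h: "\<And>\<alpha>. h \<alpha> \<noteq> 0 \<Longrightarrow> mdeg \<alpha> \<le> d" "h \<alpha>0 \<noteq> 0" "mdeg \<alpha>0 = d" "mpoly_eval h 0 \<noteq> 0"
    and gen: "\<And>p. real_polynomial_function p \<Longrightarrow> (\<And>x. mpoly_eval h x = 0 \<Longrightarrow> p x = 0) \<Longrightarrow>
       \<exists>s. real_polynomial_function s \<and> (\<forall>x. p x = mpoly_eval h x * s x)"
    and q: "\<And>\<alpha>. q \<alpha> \<noteq> 0 \<Longrightarrow> mdeg \<alpha> \<le> d" "q (\<lambda>_. 0) = 0"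
    and eq: "\<And>\<alpha>. mdeg \<alpha> \<le> 2 * d \<Longrightarrow> (\<Sum>\<beta>\<in>{\<beta>. mdeg \<beta> \<le> d}.
       real (CARD('n) + mdeg \<alpha> + mdeg \<beta>) * moment G (\<lambda>i. \<alpha> i + \<beta> i) * q \<beta>) = 0"
  shows "q \<alpha> = 0"
proof -
  let ?S = "{\<alpha>::'n \<Rightarrow> nat. mdeg \<alpha> \<le> d}"
  define H where "H = mpoly_eval h"
  define Q where "Q = mpoly_eval q"
  have Q: "Q = (\<lambda>x. \<Sum>\<alpha>\<in>?S. q \<alpha> * mmonom \<alpha> x)"
    unfolding Q_def using q by (intro ext mpoly_eval_eq_sum finite_mdeg_le) auto
  have H: "H = (\<lambda>x. \<Sum>\<alpha>\<in>?S. h \<alpha> * mmonom \<alpha> x)"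
    unfolding H_def using h by (intro ext mpoly_eval_eq_sum finite_mdeg_le) auto
  have pQ: "real_polynomial_function Q" and pH: "real_polynomial_function H"
    unfolding Q_def H_def using q h
    by (auto intro!: real_polynomial_function_mpoly_eval is_mpolyI[OF finite_mdeg_le[of d]])
  obtain H' where H': "\<And>x. (H has_derivative H' x) (at x)" "\<And>v. real_polynomial_function (\<lambda>x. H' x v)"
    using real_polynomial_function_has_derivative[OF pH] by blast
  obtain Q' where Q': "\<And>x. (Q has_derivative Q' x) (at x)" "\<And>v. real_polynomial_function (\<lambda>x. Q' x v)"
    using real_polynomial_function_has_derivative[OF pQ] by blast
  interpret polynomial_frontier G H H'
    using G H' pH by unfold_locales (auto simp: H_def)
  \<comment> \<open>The product of \<open>Q\<close> and the radial derivative of \<open>H\<close>,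
    multiplied out over pairs of exponents without collecting equal sums. Each exponent
    \<open>sh a\<close> has degree at most \<open>2 * d\<close>, so the row for it is available, and
    \<open>R\<close> is the matching combination of rows.\<close>
  define r where "r = (\<lambda>(\<beta>, \<gamma>). q \<beta> * (h \<gamma> * real (mdeg \<gamma>)))"
  define sh where "sh = (\<lambda>(\<beta>::'n \<Rightarrow> nat, \<gamma>::'n \<Rightarrow> nat) i. \<beta> i + \<gamma> i)"
  define R where "R = (\<lambda>x. \<Sum>a\<in>?S \<times> ?S. r a * mmonom (sh a) x)"
  have EH: "H' x x = (\<Sum>\<gamma>\<in>?S. h \<gamma> * real (mdeg \<gamma>) * mmonom \<gamma> x)" for x
    by (rule mmonom_sum_Euler[where r = h and \<alpha> = "\<lambda>\<gamma>. \<gamma>", OF H'(1)[of x, unfolded H]])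
  have EQ: "Q' x x = (\<Sum>\<gamma>\<in>?S. q \<gamma> * real (mdeg \<gamma>) * mmonom \<gamma> x)" for x
    by (rule mmonom_sum_Euler[where r = q and \<alpha> = "\<lambda>\<gamma>. \<gamma>", OF Q'(1)[of x, unfolded Q]])
  have RQ: "R x = Q x * H' x x" for x
    unfolding R_def Q EH sum_product sum.cartesian_product
    by (intro sum.cong) (auto simp: r_def sh_def mmonom_add)
  have pR: "real_polynomial_function R" unfolding R_def
    by (intro real_polynomial_function_sum finite_cartesian_product finite_mdeg_le
        real_polynomial_function.intros(2,4) real_polynomial_function_mmonom)
  obtain R' where R': "\<And>x. (R has_derivative R' x) (at x)" "\<And>v. real_polynomial_function (\<lambda>x. R' x v)"
    using real_polynomial_function_has_derivative[OF pR] by blast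
  have ER: "R' x x = (\<Sum>a\<in>?S \<times> ?S. r a * real (mdeg (sh a)) * mmonom (sh a) x)" for x
    by (rule mmonom_sum_Euler[OF R'(1)[of x, unfolded R_def]])
  have psi: "(\<lambda>x. (Q x)\<^sup>2 * H' x x) = (\<lambda>x. R x * Q x)"
    by (simp add: RQ power2_eq_square mult_ac)
  let ?D = "\<lambda>a x. mmonom (sh a) x * (real (CARD('n) + mdeg (sh a)) * Q x + Q' x x)"
  have "(LINT x:G|lborel. real CARD('n) * (R x * Q x) + (R x * Q' x x + R' x x * Q x))
     = (LINT x:G|lborel. \<Sum>a\<in>?S \<times> ?S. r a * ?D a x)"
    unfolding ER R_def
    by (intro arg_cong[where f = "set_lebesgue_integral lborel G"] ext)
       (simp add: sum_distrib_left sum_distrib_right sum.distrib[symmetric] algebra_simps)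
  also have "\<dots> = (\<Sum>a\<in>?S \<times> ?S. r a * (LINT x:G|lborel. ?D a x))"
    by (intro set_integral_sum_continuous G continuous_intros real_polynomial_function_continuous_on
        real_polynomial_function_mmonom pQ real_polynomial_function_radial_derivative[OF Q'])
  also have "\<dots> = 0"
  proof (intro sum.neutral ballI)
    fix a assume "a \<in> ?S \<times> ?S"
    then have "mdeg (sh a) \<le> 2 * d" by (auto simp: sh_def mdeg_add)
    then have "(LINT x:G|lborel. ?D a x) = 0"
      using eq[of "sh a"] unfolding moment_sum_eq_divergence[OF G(1,2)] Q EQ by simp
    then show "r a * (LINT x:G|lborel. ?D a x) = 0" by simp
  qed
  finally have zero: "(LINT x:G|lborel. real CARD('n) * (R x * Q x) + (R x * Q' x x + R' x x * Q x)) = 0" .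
  have "Q x * H' x x = 0" if "H x = 0" for x
  proof (rule divergence_zero_imp_vanishing[where \<psi>' = "\<lambda>x v. R x * Q' x v + R' x v * Q x"])
    show "0 < H x" if "x \<in> G" for x using pos that by (simp add: H_def)
    show "((\<lambda>x. (Q x)\<^sup>2 * H' x x) has_derivative (\<lambda>v. R x * Q' x v + R' x v * Q x)) (at x)" for x
      unfolding psi by (intro has_derivative_mult R' Q')
    show "real_polynomial_function (\<lambda>x. R x * Q' x v + R' x v * Q x)" for v
      by (intro real_polynomial_function.intros(3,4) pR pQ Q' R')
    show "(LINT x:G|lborel. real CARD('n) * ((Q x)\<^sup>2 * H' x x) + (R x * Q' x x + R' x x * Q x)) = 0"
      using zero fun_cong[OF psi] by simp
  qed (use pQ that in auto)
  moreover have "real_polynomial_function (\<lambda>x. Q x * H' x x)"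
    by (intro real_polynomial_function.intros(4) pQ real_polynomial_function_radial_derivative[OF H'])
  ultimately obtain s where s: "real_polynomial_function s" "\<And>x. Q x * H' x x = H x * s x"
    using gen unfolding H_def by meson
  have "Q x = 0" if "H x = 0" for x
    using zero_of_radial_derivative_multiple[OF pH _ H'(1) pQ s that] h(4) by (simp add: H_def)
  then obtain u where "real_polynomial_function u" "\<And>x. Q x = H x * u x"
    using gen[OF pQ] unfolding H_def by blast
  then show ?thesis
    using mpoly_multiple_eq_0[of h d \<alpha>0 q u \<alpha>] h q unfolding Q_def H_def by blast
qed

lemma mpoly_eval_zero: "is_mpoly c \<Longrightarrow> mpoly_eval c 0 = c (\<lambda>_. 0)"
proof -
  assume "is_mpoly c"
  then have fin: "finite (insert (\<lambda>_. 0) {\<alpha>. c \<alpha> \<noteq> 0})" by (simp add: is_mpoly_def)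
  have mm: "mmonom \<alpha> 0 = (if \<alpha> = (\<lambda>_. 0) then 1 else 0)" for \<alpha> :: "'a \<Rightarrow> nat"
    using mmonom_scaleR[of \<alpha> 0 "\<chi> i. 1"] mdeg_eq_0_iff[of \<alpha>] by (auto simp: power_0_left)
  show ?thesis
    by (subst mpoly_eval_eq_sum[OF fin]) (auto simp: mm if_distrib[of "\<lambda>t. _ * t"] sum.delta[OF fin] cong: if_cong)
qed

text \<open>A solution vector is a coefficient function that is zero off the index range, so
  uniqueness is meaningful for functions on all exponents. Equality of the frontier with the zero
  set of its ideal expresses that it is real algebraic.\<close>

theorem theorem1:
  fixes G :: "(real^'n::finite) set" and h :: "('n \<Rightarrow> nat) \<Rightarrow> real" and d :: nat
  assumes "open G" and "bounded G" and "G = interior (closure G)"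
    and "generates_ideal h (vanishing_ideal (frontier G))"
    and "frontier G = real_zero_set (vanishing_ideal (frontier G))"
    and "mpoly_degree h = d"
    and "0 \<notin> real_zero_set (vanishing_ideal (frontier G))"
  shows "(\<exists>!g :: ('n \<Rightarrow> nat) \<Rightarrow> real.
           (\<forall>\<beta>. g \<beta> \<noteq> 0 \<longrightarrow> 0 < mdeg \<beta> \<and> mdeg \<beta> \<le> d) \<and>
           (\<forall>\<alpha>. mdeg \<alpha> \<le> 2 * d \<longrightarrow>
              - moment G \<alpha> + (\<Sum>\<beta>\<in>{\<beta>. 0 < mdeg \<beta> \<and> mdeg \<beta> \<le> d}.
                  (real (CARD('n) + mdeg \<alpha> + mdeg \<beta>) / real (CARD('n) + mdeg \<alpha>))
                  * moment G (\<lambda>i. \<alpha> i + \<beta> i) * g \<beta>) = 0)) \<and>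
         (\<forall>g :: ('n \<Rightarrow> nat) \<Rightarrow> real.
           ((\<forall>\<beta>. g \<beta> \<noteq> 0 \<longrightarrow> 0 < mdeg \<beta> \<and> mdeg \<beta> \<le> d) \<and>
           (\<forall>\<alpha>. mdeg \<alpha> \<le> 2 * d \<longrightarrow>
              - moment G \<alpha> + (\<Sum>\<beta>\<in>{\<beta>. 0 < mdeg \<beta> \<and> mdeg \<beta> \<le> d}.
                  (real (CARD('n) + mdeg \<alpha> + mdeg \<beta>) / real (CARD('n) + mdeg \<alpha>))
                  * moment G (\<lambda>i. \<alpha> i + \<beta> i) * g \<beta>) = 0))
           \<longrightarrow> (\<forall>x\<in>frontier G. mpoly_eval g x = 1))"
proof -
  let ?I = "vanishing_ideal (frontier G)" and ?S = "{\<beta>::'n \<Rightarrow> nat. mdeg \<beta> \<le> d}"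
  let ?S' = "{\<beta>::'n \<Rightarrow> nat. 0 < mdeg \<beta> \<and> mdeg \<beta> \<le> d}"
  define H where "H = mpoly_eval h"
  have hI: "h \<in> ?I" and mh: "is_mpoly h"
    using assms(4) by (auto simp: generates_ideal_def vanishing_ideal_def)
  have dvd: "\<exists>s. is_mpoly s \<and> (\<forall>x. mpoly_eval p x = H x * mpoly_eval s x)" if "p \<in> ?I" for p
    using assms(4) that by (auto simp: generates_ideal_def H_def)
  have pH: "real_polynomial_function H" unfolding H_def by (rule real_polynomial_function_mpoly_eval[OF mh])
  have "real_zero_set ?I = {x. H x = 0}"
    using hI dvd unfolding real_zero_set_def H_def by force
  then have fr: "frontier G = {x. H x = 0}" and H0: "H 0 \<noteq> 0" using assms(5,7) by auto
  \<comment> \<open>Since the zero set of \<open>H\<close> is the frontier, vanishing wherever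
    \<open>H\<close> does amounts to membership in the ideal.\<close>
  have gen: "\<exists>s. real_polynomial_function s \<and> (\<forall>x. p x = H x * s x)"
    if pp: "real_polynomial_function p" and pz: "\<And>x. H x = 0 \<Longrightarrow> p x = 0" for p
  proof -
    obtain c where c: "is_mpoly c" "\<And>x. mpoly_eval c x = p x"
      using real_polynomial_function_imp_mpoly[OF pp] by blast
    then have "c \<in> ?I" using pz by (simp add: vanishing_ideal_def fr)
    then obtain s where "is_mpoly s" "\<And>x. mpoly_eval c x = H x * mpoly_eval s x" using dvd by blast
    then show ?thesis using c real_polynomial_function_mpoly_eval by metis
  qed
  have h0: "h (\<lambda>_. 0) = H 0" unfolding H_def using mpoly_eval_zero[OF mh] by simp
  have fin: "finite (insert 0 (mdeg ` {\<alpha>. h \<alpha> \<noteq> 0}))" using mh by (simp add: is_mpoly_def)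
  have hd: "mdeg \<alpha> \<le> d" if "h \<alpha> \<noteq> 0" for \<alpha>
    using Max_ge[OF fin, of "mdeg \<alpha>"] that assms(6) by (simp add: mpoly_degree_def)
  \<comment> \<open>If the maximum is attained only by the default 0 inserted in
    \<open>mpoly_degree\<close>, then \<open>d = 0\<close>, and the constant coefficient
    \<open>H 0\<close> supplies the exponent.\<close>
  obtain \<alpha>0 where \<alpha>0: "h \<alpha>0 \<noteq> 0" "mdeg \<alpha>0 = d"
  proof -
    have "d \<in> insert 0 (mdeg ` {\<alpha>. h \<alpha> \<noteq> 0})"
      using Max_in[OF fin] assms(6) by (simp add: mpoly_degree_def)
    moreover have "mdeg (\<lambda>_::'n. 0) = 0" by (simp add: mdeg_def)
    ultimately show ?thesis using that[of "\<lambda>_. 0"] that h0 H0 by auto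
  qed
  obtain H' where H': "\<And>x. (H has_derivative H' x) (at x)" "\<And>v. real_polynomial_function (\<lambda>x. H' x v)"
    using real_polynomial_function_has_derivative[OF pH] by blast
  interpret polynomial_frontier G H H'
    by unfold_locales (use assms fr pH H' in auto)
  have evH: "H = (\<lambda>x. \<Sum>\<beta>\<in>?S. h \<beta> * mmonom \<beta> x)"
    unfolding H_def using hd by (intro ext mpoly_eval_eq_sum finite_mdeg_le) auto
  have h_sol: "(\<Sum>\<beta>\<in>?S. real (CARD('n) + mdeg \<alpha> + mdeg \<beta>) * moment G (\<lambda>i. \<alpha> i + \<beta> i) * h \<beta>) = 0" for \<alpha>
  proof -
    obtain m' where m': "\<And>x. (mmonom \<alpha> has_derivative m' x) (at x)" "\<And>v. real_polynomial_function (\<lambda>x. m' x v)"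
      using real_polynomial_function_has_derivative[OF real_polynomial_function_mmonom[of \<alpha>]] by blast
    have "m' x x = real (mdeg \<alpha>) * mmonom \<alpha> x" for x
      using mmonom_sum_Euler[of "\<lambda>_. 1" "\<lambda>_. \<alpha>" "{()}" "m' x" x] m'(1)[of x] by simp
    moreover have "H' x x = (\<Sum>\<gamma>\<in>?S. h \<gamma> * real (mdeg \<gamma>) * mmonom \<gamma> x)" for x
      by (rule mmonom_sum_Euler[where r = h and \<alpha> = "\<lambda>\<gamma>. \<gamma>", OF H'(1)[of x, unfolded evH]])
    ultimately show ?thesis
      using divergence_multiple[OF real_polynomial_function_mmonom m']
      unfolding moment_sum_eq_divergence[OF assms(1,2)] evH[symmetric] fun_cong[OF evH, symmetric]
      by (simp add: algebra_simps)
  qed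
  have kernel: "q \<beta> = 0"
    if q: "\<And>\<beta>. q \<beta> \<noteq> 0 \<Longrightarrow> mdeg \<beta> \<le> d" "q (\<lambda>_. 0) = 0"
      and eq: "\<And>\<alpha>. mdeg \<alpha> \<le> 2 * d \<Longrightarrow> (\<Sum>\<beta>\<in>?S.
         real (CARD('n) + mdeg \<alpha> + mdeg \<beta>) * moment G (\<lambda>i. \<alpha> i + \<beta> i) * q \<beta>) = 0" for q \<beta>
    using constant_sign[OF assms(1,3) fr pH H0 H' gen]
  proof
    assume "\<forall>x\<in>G. 0 < H x"
    then show ?thesis
      using moment_kernel_trivial[OF assms(1,2), of h d \<alpha>0 q \<beta>] fr hd \<alpha>0 H0 gen q eq unfolding H_def by blast
  next
    \<comment> \<open>Replacing \<open>h\<close> by its negative keeps the zero set, the degree and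
      divisibility, and restores positivity on \<open>G\<close>.\<close>
    assume neg: "\<forall>x\<in>G. H x < 0"
    have minus: "mpoly_eval (\<lambda>\<alpha>. - h \<alpha>) x = - H x" for x
      by (simp add: mpoly_eval_def H_def sum_negf)
    show ?thesis
    proof (rule moment_kernel_trivial[OF assms(1,2), of "\<lambda>\<alpha>. - h \<alpha>" d \<alpha>0])
      fix p :: "real^'n \<Rightarrow> real"
      assume "real_polynomial_function p" "\<And>x. mpoly_eval (\<lambda>\<alpha>. - h \<alpha>) x = 0 \<Longrightarrow> p x = 0"
      then obtain s where "real_polynomial_function s" "\<And>x. p x = H x * s x"
        using gen[of p] by (auto simp: minus)
      then show "\<exists>s. real_polynomial_function s \<and> (\<forall>x. p x = mpoly_eval (\<lambda>\<alpha>. - h \<alpha>) x * s x)"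
        by (intro exI[of _ "\<lambda>x. - s x"]) (auto simp: minus)
    qed (use fr hd \<alpha>0 H0 q eq neg minus in auto)
  qed
  define Sol where "Sol = (\<lambda>g :: ('n \<Rightarrow> nat) \<Rightarrow> real.
           (\<forall>\<beta>. g \<beta> \<noteq> 0 \<longrightarrow> 0 < mdeg \<beta> \<and> mdeg \<beta> \<le> d) \<and>
           (\<forall>\<alpha>. mdeg \<alpha> \<le> 2 * d \<longrightarrow>
              - moment G \<alpha> + (\<Sum>\<beta>\<in>?S'.
                  (real (CARD('n) + mdeg \<alpha> + mdeg \<beta>) / real (CARD('n) + mdeg \<alpha>))
                  * moment G (\<lambda>i. \<alpha> i + \<beta> i) * g \<beta>) = 0))"
  \<comment> \<open>Multiplying each row by \<open>CARD('n) + mdeg \<alpha>\<close> clears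
    denominators, and the entry - 1 at exponent zero absorbs the inhomogeneous term, so solutions
    become kernel vectors.\<close>
  have Sol_iff: "Sol g \<longleftrightarrow> (\<forall>\<beta>. g \<beta> \<noteq> 0 \<longrightarrow> 0 < mdeg \<beta> \<and> mdeg \<beta> \<le> d) \<and>
     (\<forall>\<alpha>. mdeg \<alpha> \<le> 2 * d \<longrightarrow> (\<Sum>\<beta>\<in>?S. real (CARD('n) + mdeg \<alpha> + mdeg \<beta>)
        * moment G (\<lambda>i. \<alpha> i + \<beta> i) * (if \<beta> = (\<lambda>_. 0) then - 1 else g \<beta>)) = 0)" for g
  proof -
    have nz: "real CARD('n) + real (mdeg \<alpha>) \<noteq> 0" for \<alpha> :: "'n \<Rightarrow> nat"
      by (simp add: add_nonneg_eq_0_iff)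
    have S: "?S = insert (\<lambda>_. 0) ?S'" "(\<lambda>_. 0) \<notin> ?S'" "finite ?S'"
      using finite_subset[OF _ finite_mdeg_le[of d], of ?S'] mdeg_eq_0_iff by (auto simp: mdeg_def)
    have "(\<Sum>\<beta>\<in>?S. real (CARD('n) + mdeg \<alpha> + mdeg \<beta>)
        * moment G (\<lambda>i. \<alpha> i + \<beta> i) * (if \<beta> = (\<lambda>_. 0) then - 1 else g \<beta>))
      = real (CARD('n) + mdeg \<alpha>) * (- moment G \<alpha> + (\<Sum>\<beta>\<in>?S'.
                  (real (CARD('n) + mdeg \<alpha> + mdeg \<beta>) / real (CARD('n) + mdeg \<alpha>))
                  * moment G (\<lambda>i. \<alpha> i + \<beta> i) * g \<beta>))" (is "?L = ?R") for \<alpha>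
    proof -
      have "?L = - real (CARD('n) + mdeg \<alpha>) * moment G \<alpha> + (\<Sum>\<beta>\<in>?S'. real (CARD('n) + mdeg \<alpha> + mdeg \<beta>)
        * moment G (\<lambda>i. \<alpha> i + \<beta> i) * (if \<beta> = (\<lambda>_. 0) then - 1 else g \<beta>))"
        using S mdeg_eq_0_iff[of "\<lambda>_::'n. 0"] unfolding S(1) by (subst sum.insert) (auto simp: algebra_simps)
      also have "(\<Sum>\<beta>\<in>?S'. real (CARD('n) + mdeg \<alpha> + mdeg \<beta>)
        * moment G (\<lambda>i. \<alpha> i + \<beta> i) * (if \<beta> = (\<lambda>_. 0) then - 1 else g \<beta>))
        = real (CARD('n) + mdeg \<alpha>) * (\<Sum>\<beta>\<in>?S'.
                  (real (CARD('n) + mdeg \<alpha> + mdeg \<beta>) / real (CARD('n) + mdeg \<alpha>))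
                  * moment G (\<lambda>i. \<alpha> i + \<beta> i) * g \<beta>)"
        unfolding sum_distrib_left using S(2) nz[of \<alpha>] by (intro sum.cong refl) auto
      finally show ?thesis by (simp add: algebra_simps)
    qed
    then show ?thesis unfolding Sol_def using nz by simp
  qed
  \<comment> \<open>The coefficients of \<open>1 - H x / H 0\<close>: dividing by
    \<open>- H 0\<close> gives the vector of \<open>h\<close> the entry - 1 at exponent zero, as the
    system prescribes.\<close>
  define g0 where "g0 = (\<lambda>\<beta>. if \<beta> = (\<lambda>_. 0) then 0 else - h \<beta> / H 0)"
  have "Sol g0"
    unfolding Sol_iff
  proof (intro conjI allI impI)
    fix \<beta> assume "g0 \<beta> \<noteq> 0"
    then have "\<beta> \<noteq> (\<lambda>_. 0)" "h \<beta> \<noteq> 0" by (auto simp: g0_def split: if_splits)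
    then show "0 < mdeg \<beta>" "mdeg \<beta> \<le> d" using hd mdeg_eq_0_iff[of \<beta>] by auto
  next
    fix \<alpha> :: "'n \<Rightarrow> nat"
    have "(if \<beta> = (\<lambda>_. 0) then - 1 else g0 \<beta>) = h \<beta> * (- 1 / H 0)" for \<beta>
      using h0 H0 by (simp add: g0_def)
    then have "(\<Sum>\<beta>\<in>?S. real (CARD('n) + mdeg \<alpha> + mdeg \<beta>)
        * moment G (\<lambda>i. \<alpha> i + \<beta> i) * (if \<beta> = (\<lambda>_. 0) then - 1 else g0 \<beta>))
      = (\<Sum>\<beta>\<in>?S. real (CARD('n) + mdeg \<alpha> + mdeg \<beta>) * moment G (\<lambda>i. \<alpha> i + \<beta> i) * h \<beta>) * (- 1 / H 0)"
      unfolding sum_distrib_right by (simp only: mult.assoc)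
    then show "(\<Sum>\<beta>\<in>?S. real (CARD('n) + mdeg \<alpha> + mdeg \<beta>)
        * moment G (\<lambda>i. \<alpha> i + \<beta> i) * (if \<beta> = (\<lambda>_. 0) then - 1 else g0 \<beta>)) = 0"
      unfolding h_sol by simp
  qed
  have uniq: "g = g0" if "Sol g" for g
  proof
    fix \<beta>
    have "g (\<lambda>_. 0) = 0" using that unfolding Sol_def by (auto simp: mdeg_def)
    have "g \<beta> - g0 \<beta> = 0"
    proof (rule kernel[of "\<lambda>\<beta>. g \<beta> - g0 \<beta>"])
      show "mdeg \<beta> \<le> d" if "g \<beta> - g0 \<beta> \<noteq> 0" for \<beta>
        using \<open>Sol g\<close> \<open>Sol g0\<close> that unfolding Sol_def by (cases "g \<beta> = 0") auto
      show "g (\<lambda>_. 0) - g0 (\<lambda>_. 0) = 0" using \<open>g (\<lambda>_. 0) = 0\<close> by (simp add: g0_def)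
    next
      fix \<alpha> :: "'n \<Rightarrow> nat" assume \<alpha>: "mdeg \<alpha> \<le> 2 * d"
      let ?w = "\<lambda>\<beta>. real (CARD('n) + mdeg \<alpha> + mdeg \<beta>) * moment G (\<lambda>i. \<alpha> i + \<beta> i)"
      have "g \<beta> - g0 \<beta> = (if \<beta> = (\<lambda>_. 0) then - 1 else g \<beta>) - (if \<beta> = (\<lambda>_. 0) then - 1 else g0 \<beta>)" for \<beta>
        using \<open>g (\<lambda>_. 0) = 0\<close> by (simp add: g0_def)
      then have "(\<Sum>\<beta>\<in>?S. ?w \<beta> * (g \<beta> - g0 \<beta>)) = (\<Sum>\<beta>\<in>?S. ?w \<beta> * (if \<beta> = (\<lambda>_. 0) then - 1 else g \<beta>))
         - (\<Sum>\<beta>\<in>?S. ?w \<beta> * (if \<beta> = (\<lambda>_. 0) then - 1 else g0 \<beta>))"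
        by (simp only: right_diff_distrib sum_subtractf)
      also have "\<dots> = 0" using \<open>Sol g\<close> \<open>Sol g0\<close> \<alpha> unfolding Sol_iff by simp
      finally show "(\<Sum>\<beta>\<in>?S. ?w \<beta> * (g \<beta> - g0 \<beta>)) = 0" .
    qed
    then show "g \<beta> = g0 \<beta>" by simp
  qed
  have "mpoly_eval g0 x = 1" if "x \<in> frontier G" for x
  proof -
    have "mpoly_eval g0 x = (\<Sum>\<beta>\<in>?S. g0 \<beta> * mmonom \<beta> x)"
      using \<open>Sol g0\<close> unfolding Sol_def by (intro mpoly_eval_eq_sum finite_mdeg_le) auto
    also have "\<dots> = (\<Sum>\<beta>\<in>?S. h \<beta> * mmonom \<beta> x * (- 1 / H 0) + (if \<beta> = (\<lambda>_. 0) then 1 else 0))"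
      using h0 H0 by (intro sum.cong) (auto simp: g0_def)
    also have "\<dots> = H x * (- 1 / H 0) + 1"
      unfolding sum.distrib evH sum_distrib_right
      using mdeg_eq_0_iff[of "\<lambda>_::'n. 0"] by (simp add: sum.delta[OF finite_mdeg_le])
    finally show ?thesis using that fr by simp
  qed
  then have "(\<exists>!g. Sol g) \<and> (\<forall>g. Sol g \<longrightarrow> (\<forall>x\<in>frontier G. mpoly_eval g x = 1))"
    using \<open>Sol g0\<close> uniq by blast
  then show ?thesis unfolding Sol_def .
qed

end
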